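(* Let $F$ be an infinite field with $\operatorname{char}(F)\neq 2$, and let $A$, $B$ and the Jordan isomorphism $\varphi:A\to H(B,* )$, $\varphi(a)=a+a^{\rm op}$, be as constructed in the context. Then for an arbitrary T-ideal $P$ of the free associative $F$-algebra on countably many generators, the restriction of $\varphi$ to $P(A)$, viewed as a Jordan homomorphism $P(A)\to B$, is not standard.
   Context: Algebras are associative over $F$, not assumed unital; $x\circ y=xy+yx$; a Jordan homomorphism is a linear map preserving $\circ$. A T-ideal of the free associative algebra is an ideal invariant under all its endomorphisms (T-ideals are also taken to be closed under partial linearizations, which is automatic since $F$ is infinite); $P(A)$ is the ideal of $A$ consisting of all values on $A$ of elements of $P$. A Jordan homomorphism $\psi:C\to B$ from an algebra $C$ is standard if there are a homomorphism $\psi_1:C\to B$ and an antihomomorphism $\psi_2:C\to B$ with $\psi=\psi_1+\psi_2$ and $\psi_1(C)\psi_2(C)=\psi_2(C)\psi_1(C)=(0)$. Construction of $A$, $B$, $\varphi$. Semigroup. Let $X$ be a finite alphabet and $X^*$ the free semigroup of all nonempty words in $X$. A congruence on $X^*$ is an equivalence relation $\sim$ such that $u_1\sim v_1$, $u_2\sim v_2$ imply $u_1u_2\sim v_1v_2$; it is graded if $u\sim v$ implies ${\rm length}(u)={\rm length}(v)$. For $\sigma\subset X^*\times X^*$, "$u=v$ follows from $\sigma$" means that $(u,v)$ lies in the smallest congruence containing $\sigma$. The semigroup $X^*/\sim$ is finitely presented if it has a presentation with finitely many generators and finitely many relations. Given a graded congruence $\sim$, define $\sim_{in}$: for words $u,v$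 of the same length $n$, $u\sim_{in}v$ if $u=v$ follows from $\{(u',v') : {\rm length}(u')={\rm length}(v')<n,\ u'\sim v'\}$. Fix a graded congruence $\sim$ such that the semigroup $S=X^*/\sim$ is not finitely presented, and fix a map $\alpha:X^*\to F$ such that $\alpha(u)=\alpha(v)$ if and only if $u\sim_{in}v$. Define $h:S\times S\to F$ by $h(u,v)=\alpha(uv)$ (this is well defined on $\sim$-classes and satisfies $h(ab,c)=h(a,bc)$). Algebra $A$. Let $FS$ be the semigroup algebra and let $A=\sum_{1\le i<j}e_{ij}(FS)$ be the algebra of strictly upper triangular infinite matrices over $FS$ with finitely many nonzero entries, $e_{ij}(a)e_{pq}(b)=\delta_{jp}e_{iq}(ab)$. Define the bilinear form $f:A\times A\to F$ by $f(e_{ij}(u),e_{pq}(v))=h(u,v)$ if $j=p$ and $f(e_{ij}(u),e_{pq}(v))=0$ otherwise, for $i<j$, $p<q$, $u,v\in S$. It satisfies $f(ab,c)=f(a,bc)$. Algebra $B$. Let $A^{\rm op}=\{a^{\rm op}: a\in A\}$ be the opposite algebra, $a^{\rm op}b^{\rm op}=(ba)^{\rm op}$. Extend $f$ to $A\oplus A^{\rm op}$ by $f(A,A^{\rm op})=f(A^{\rm op},A)=(0)$ and $f(x^{\rm op},y^{\rm op})=-f(y,x)$ for $x,y\in A$. Let $B=A\oplus A^{\rm op}\oplus Fz$ with multiplication $Bz=zB=(0)$ and $x\cdot y=xy+f(x,y)z$ for $x,y\in A\oplus A^{\rm op}$, where $xy$ is the product in $A\oplus A^{\rm op}$. This is an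 associative algebra, $*:B\to B$, $(a+b^{\rm op}+kz)^*=b+a^{\rm op}-kz$ ($a,b\in A$, $k\in F$), is an involution, $H(B,* )=\{b\in B: b^*=b\}$, and $\varphi:A\to H(B,* )$, $\varphi(a)=a+a^{\rm op}$, is a Jordan isomorphism.
   Formalization: The T-ideal P is assumed nonzero: for P = 0 one has P(A) = 0 and the restriction of φ is the zero map, which is standard, so the claim fails in that single case. *)

theory Defs
  imports "HOL-Library.Poly_Mapping" "HOL-Library.Product_Plus"
begin

section \<open>Algebras and maps between them\<close>

text \<open>
  An algebra over the field \<open>'f\<close>, not assumed unital, is given by a carrier inside an additive
  group type; addition and zero are those of the type.
\<close>

record ('f, 'a) alg =
  carr :: "'a set"
  scale :: "'f \<Rightarrow> 'a \<Rightarrow> 'a"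
  mult :: "'a \<Rightarrow> 'a \<Rightarrow> 'a"

definition assoc_alg :: "('f::field, 'a::ab_group_add) alg \<Rightarrow> bool" where
  "assoc_alg C \<longleftrightarrow>
     0 \<in> carr C \<and>
     (\<forall>x\<in>carr C. \<forall>y\<in>carr C. x + y \<in> carr C \<and> mult C x y \<in> carr C) \<and>
     (\<forall>c. \<forall>x\<in>carr C. scale C c x \<in> carr C) \<and>
     (\<forall>x\<in>carr C. scale C 1 x = x) \<and>
     (\<forall>c d. \<forall>x\<in>carr C. scale C (c + d) x = scale C c x + scale C d x \<and>
        scale C (c * d) x = scale C c (scale C d x)) \<and>
     (\<forall>c. \<forall>x\<in>carr C. \<forall>y\<in>carr C. scale C c (x + y) = scale C c x + scale C c y \<and>
        mult C (scale C c x) y = scale C c (mult C x y) \<and>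
        mult C x (scale C c y) = scale C c (mult C x y)) \<and>
     (\<forall>x\<in>carr C. \<forall>y\<in>carr C. \<forall>z\<in>carr C.
        mult C (x + y) z = mult C x z + mult C y z \<and>
        mult C x (y + z) = mult C x y + mult C x z \<and>
        mult C (mult C x y) z = mult C x (mult C y z))"

definition jprod :: "('f, 'a::ab_group_add) alg \<Rightarrow> 'a \<Rightarrow> 'a \<Rightarrow> 'a" where
  "jprod C x y = mult C x y + mult C y x"

definition linear_map ::
    "('f, 'a::ab_group_add) alg \<Rightarrow> ('f, 'b::ab_group_add) alg \<Rightarrow> ('a \<Rightarrow> 'b) \<Rightarrow> bool" where
  "linear_map C D \<psi> \<longleftrightarrow>
     (\<forall>x\<in>carr C. \<psi> x \<in> carr D) \<and>
     (\<forall>x\<in>carr C. \<forall>y\<in>carr C. \<psi> (x + y) = \<psi> x + \<psi> y) \<and>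
     (\<forall>c. \<forall>x\<in>carr C. \<psi> (scale C c x) = scale D c (\<psi> x))"

definition alg_hom ::
    "('f, 'a::ab_group_add) alg \<Rightarrow> ('f, 'b::ab_group_add) alg \<Rightarrow> ('a \<Rightarrow> 'b) \<Rightarrow> bool" where
  "alg_hom C D \<psi> \<longleftrightarrow> linear_map C D \<psi> \<and>
     (\<forall>x\<in>carr C. \<forall>y\<in>carr C. \<psi> (mult C x y) = mult D (\<psi> x) (\<psi> y))"

definition alg_antihom ::
    "('f, 'a::ab_group_add) alg \<Rightarrow> ('f, 'b::ab_group_add) alg \<Rightarrow> ('a \<Rightarrow> 'b) \<Rightarrow> bool" where
  "alg_antihom C D \<psi> \<longleftrightarrow> linear_map C D \<psi> \<and>
     (\<forall>x\<in>carr C. \<forall>y\<in>carr C. \<psi> (mult C x y) = mult D (\<psi> y) (\<psi> x))"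

definition jordan_hom ::
    "('f, 'a::ab_group_add) alg \<Rightarrow> ('f, 'b::ab_group_add) alg \<Rightarrow> ('a \<Rightarrow> 'b) \<Rightarrow> bool" where
  "jordan_hom C D \<psi> \<longleftrightarrow> linear_map C D \<psi> \<and>
     (\<forall>x\<in>carr C. \<forall>y\<in>carr C. \<psi> (jprod C x y) = jprod D (\<psi> x) (\<psi> y))"

text \<open>Only the values of \<open>\<psi>\<close> on the carrier of \<open>C\<close> matter.\<close>

definition standard ::
    "('f, 'a::ab_group_add) alg \<Rightarrow> ('f, 'b::ab_group_add) alg \<Rightarrow> ('a \<Rightarrow> 'b) \<Rightarrow> bool" where
  "standard C D \<psi> \<longleftrightarrow>
     (\<exists>\<psi>1 \<psi>2. alg_hom C D \<psi>1 \<and> alg_antihom C D \<psi>2 \<and>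
        (\<forall>x\<in>carr C. \<psi> x = \<psi>1 x + \<psi>2 x) \<and>
        (\<forall>x\<in>carr C. \<forall>y\<in>carr C.
           mult D (\<psi>1 x) (\<psi>2 y) = 0 \<and> mult D (\<psi>2 x) (\<psi>1 y) = 0))"

definition alg_ideal :: "('f, 'a::ab_group_add) alg \<Rightarrow> 'a set \<Rightarrow> bool" where
  "alg_ideal C I \<longleftrightarrow> I \<subseteq> carr C \<and> 0 \<in> I \<and>
     (\<forall>x\<in>I. \<forall>y\<in>I. x + y \<in> I) \<and>
     (\<forall>c. \<forall>x\<in>I. scale C c x \<in> I) \<and>
     (\<forall>x\<in>I. \<forall>a\<in>carr C. mult C a x \<in> I \<and> mult C x a \<in> I)"

definition is_involution :: "('f, 'a::ab_group_add) alg \<Rightarrow> ('a \<Rightarrow> 'a) \<Rightarrow> bool" where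
  "is_involution C s \<longleftrightarrow> alg_antihom C C s \<and> (\<forall>x\<in>carr C. s (s x) = x)"

definition hermitian :: "('f, 'a::ab_group_add) alg \<Rightarrow> ('a \<Rightarrow> 'a) \<Rightarrow> 'a set" where
  "hermitian C s = {x \<in> carr C. s x = x}"


section \<open>Semigroups, words and congruences\<close>

record 's sgrp =
  selems :: "'s set"
  sop :: "'s \<Rightarrow> 's \<Rightarrow> 's"

definition words :: "'x set \<Rightarrow> 'x list set" where
  "words X = {w. w \<noteq> [] \<and> set w \<subseteq> X}"

definition free_sgrp :: "'x set \<Rightarrow> 'x list sgrp" where
  "free_sgrp X = \<lparr>selems = words X, sop = (@)\<rparr>"

definition congruence :: "'x set \<Rightarrow> ('x list \<times> 'x list) set \<Rightarrow> bool" where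
  "congruence X r \<longleftrightarrow> equiv (words X) r \<and>
     (\<forall>u1 v1 u2 v2. (u1, v1) \<in> r \<longrightarrow> (u2, v2) \<in> r \<longrightarrow> (u1 @ u2, v1 @ v2) \<in> r)"

definition graded_congruence :: "'x set \<Rightarrow> ('x list \<times> 'x list) set \<Rightarrow> bool" where
  "graded_congruence X r \<longleftrightarrow> congruence X r \<and> (\<forall>(u, v)\<in>r. length u = length v)"

text \<open>\<open>(u, v) \<in> cong_closure X \<sigma>\<close> says that \<open>u = v\<close> follows from \<open>\<sigma>\<close>.\<close>

definition cong_closure ::
    "'x set \<Rightarrow> ('x list \<times> 'x list) set \<Rightarrow> ('x list \<times> 'x list) set" where
  "cong_closure X \<sigma> = \<Inter>{r. congruence X r \<and> \<sigma> \<subseteq> r}"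

definition quotient_sgrp :: "'x set \<Rightarrow> ('x list \<times> 'x list) set \<Rightarrow> 'x list set sgrp" where
  "quotient_sgrp X r =
     \<lparr>selems = words X // r, sop = (\<lambda>U V. \<Union>u\<in>U. \<Union>v\<in>V. r `` {u @ v})\<rparr>"

definition sgrp_iso :: "'s sgrp \<Rightarrow> 't sgrp \<Rightarrow> bool" where
  "sgrp_iso S T \<longleftrightarrow> (\<exists>\<pi>. bij_betw \<pi> (selems S) (selems T) \<and>
     (\<forall>a\<in>selems S. \<forall>b\<in>selems S. \<pi> (sop S a b) = sop T (\<pi> a) (\<pi> b)))"

text \<open>Every finite alphabet can be renamed to a finite set of natural numbers.\<close>

definition finitely_presented :: "'s sgrp \<Rightarrow> bool" where
  "finitely_presented S \<longleftrightarrow>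
     (\<exists>(Y :: nat set) \<sigma>. finite Y \<and> finite \<sigma> \<and> \<sigma> \<subseteq> words Y \<times> words Y \<and>
        sgrp_iso S (quotient_sgrp Y (cong_closure Y \<sigma>)))"

definition sim_in :: "'x set \<Rightarrow> ('x list \<times> 'x list) set \<Rightarrow> ('x list \<times> 'x list) set" where
  "sim_in X r = {(u, v). u \<in> words X \<and> v \<in> words X \<and> length u = length v \<and>
     (u, v) \<in> cong_closure X
        {(u', v') \<in> r. length u' = length v' \<and> length u' < length u}}"


section \<open>Semigroup algebras, free algebras and T-ideals\<close>

definition bilinear_ext ::
    "('k \<Rightarrow> 'l \<Rightarrow> 'a \<Rightarrow> 'b \<Rightarrow> 'c) \<Rightarrow> ('k \<Rightarrow>\<^sub>0 'a::zero) \<Rightarrow> ('l \<Rightarrow>\<^sub>0 'b::zero) \<Rightarrow> 'c::comm_monoid_add"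
  where
  "bilinear_ext K a b =
     (\<Sum>u\<in>Poly_Mapping.keys a. \<Sum>v\<in>Poly_Mapping.keys b.
        K u v (Poly_Mapping.lookup a u) (Poly_Mapping.lookup b v))"

definition sgrp_alg :: "'s sgrp \<Rightarrow> ('f::field, 's \<Rightarrow>\<^sub>0 'f) alg" where
  "sgrp_alg S =
     \<lparr>carr = {a. Poly_Mapping.keys a \<subseteq> selems S},
      scale = (\<lambda>c. Poly_Mapping.map ((*) c)),
      mult = bilinear_ext (\<lambda>u v x y. Poly_Mapping.single (sop S u v) (x * y))\<rparr>"

text \<open>Since words are nonempty, the free algebra has no unit.\<close>

definition free_alg :: "('f::field, nat list \<Rightarrow>\<^sub>0 'f) alg" where
  "free_alg = sgrp_alg (free_sgrp UNIV)"

text \<open>Closure under partial linearizations is automatic over an infinite field, hence not required.\<close>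

definition T_ideal :: "(nat list \<Rightarrow>\<^sub>0 'f::field) set \<Rightarrow> bool" where
  "T_ideal P \<longleftrightarrow> alg_ideal free_alg P \<and>
     (\<forall>\<theta>. alg_hom free_alg free_alg \<theta> \<longrightarrow> \<theta> ` P \<subseteq> P)"

fun word_prod :: "('f, 'a::ab_group_add) alg \<Rightarrow> 'a list \<Rightarrow> 'a" where
  "word_prod C [] = 0"
| "word_prod C [x] = x"
| "word_prod C (x # y # ys) = mult C x (word_prod C (y # ys))"

definition eval_at ::
    "('f::field, 'a::ab_group_add) alg \<Rightarrow> (nat \<Rightarrow> 'a) \<Rightarrow> (nat list \<Rightarrow>\<^sub>0 'f) \<Rightarrow> 'a" where
  "eval_at C s p =
     (\<Sum>w\<in>Poly_Mapping.keys p. scale C (Poly_Mapping.lookup p w) (word_prod C (map s w)))"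

definition values_on :: "(nat list \<Rightarrow>\<^sub>0 'f::field) set \<Rightarrow> ('f, 'a::ab_group_add) alg \<Rightarrow> 'a set" where
  "values_on P C = {eval_at C s p | s p. p \<in> P \<and> range s \<subseteq> carr C}"

text \<open>
  \<open>verbal P C\<close> is \<open>P(C)\<close> as an algebra in its own right: for a T-ideal \<open>P\<close>, the set of values is an
  ideal of \<open>C\<close>, because variables can be renamed apart.
\<close>

definition verbal ::
    "(nat list \<Rightarrow>\<^sub>0 'f::field) set \<Rightarrow> ('f, 'a::ab_group_add) alg \<Rightarrow> ('f, 'a) alg" where
  "verbal P C = C\<lparr>carr := values_on P C\<rparr>"


section \<open>The algebras \<open>A\<close> and \<open>B\<close> and the map \<open>\<phi>\<close>\<close>

type_synonym ('k, 'f) mat = "(nat \<times> nat) \<Rightarrow>\<^sub>0 ('k \<Rightarrow>\<^sub>0 'f)"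

definition strict_upper ::
    "('f, 'r::ab_group_add) alg \<Rightarrow> ('f, (nat \<times> nat) \<Rightarrow>\<^sub>0 'r) alg" where
  "strict_upper R =
     \<lparr>carr = {m. \<forall>(i, j)\<in>Poly_Mapping.keys m.
                   1 \<le> i \<and> i < j \<and> Poly_Mapping.lookup m (i, j) \<in> carr R},
      scale = (\<lambda>c. Poly_Mapping.map (scale R c)),
      mult = bilinear_ext (\<lambda>(i, j) (p, q) a b.
               if j = p then Poly_Mapping.single (i, q) (mult R a b) else 0)\<rparr>"

definition alg_A :: "'x set \<Rightarrow> ('x list \<times> 'x list) set \<Rightarrow> ('f::field, ('x list set, 'f) mat) alg"
  where
  "alg_A X r = strict_upper (sgrp_alg (quotient_sgrp X r))"

text \<open>The common value of \<open>\<alpha> (u @ v)\<close> over representatives of two \<open>r\<close>-classes.\<close>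

definition form_h :: "('x list \<Rightarrow> 'f) \<Rightarrow> 'x list set \<Rightarrow> 'x list set \<Rightarrow> 'f" where
  "form_h \<alpha> U V = the_elem (\<Union>u\<in>U. \<Union>v\<in>V. {\<alpha> (u @ v)})"

definition form_f ::
    "('x list \<Rightarrow> 'f::field) \<Rightarrow> ('x list set, 'f) mat \<Rightarrow> ('x list set, 'f) mat \<Rightarrow> 'f" where
  "form_f \<alpha> = bilinear_ext (\<lambda>(i, j) (p, q) a b.
     if j = p then bilinear_ext (\<lambda>u v x y. x * y * form_h \<alpha> u v) a b else 0)"

definition op_alg :: "('f, 'a) alg \<Rightarrow> ('f, 'a) alg" where
  "op_alg C = C\<lparr>mult := (\<lambda>x y. mult C y x)\<rparr>"

definition direct_sum :: "('f, 'a) alg \<Rightarrow> ('f, 'b) alg \<Rightarrow> ('f, 'a \<times> 'b) alg" where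
  "direct_sum C D =
     \<lparr>carr = carr C \<times> carr D,
      scale = (\<lambda>c (x, y). (scale C c x, scale D c y)),
      mult = (\<lambda>(x, y) (x', y'). (mult C x x', mult D y y'))\<rparr>"

text \<open>The pair \<open>(x, k)\<close> stands for \<open>x + kz\<close>.\<close>

definition central_ext ::
    "('f::field, 'a) alg \<Rightarrow> ('a \<Rightarrow> 'a \<Rightarrow> 'f) \<Rightarrow> ('f, 'a \<times> 'f) alg" where
  "central_ext C g =
     \<lparr>carr = carr C \<times> UNIV,
      scale = (\<lambda>c (x, k). (scale C c x, c * k)),
      mult = (\<lambda>(x, k) (y, l). (mult C x y, g x y))\<rparr>"

definition form_ext :: "('a \<Rightarrow> 'a \<Rightarrow> 'f::field) \<Rightarrow> 'a \<times> 'a \<Rightarrow> 'a \<times> 'a \<Rightarrow> 'f" where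
  "form_ext g = (\<lambda>(a, b) (a', b'). g a a' - g b' b)"

text \<open>The element \<open>((a, b), k)\<close> of \<open>alg_B X r \<alpha>\<close> stands for \<open>a + b\<^sup>o\<^sup>p + kz\<close>.\<close>

definition alg_B :: "'x set \<Rightarrow> ('x list \<times> 'x list) set \<Rightarrow> ('x list \<Rightarrow> 'f::field) \<Rightarrow>
    ('f, (('x list set, 'f) mat \<times> ('x list set, 'f) mat) \<times> 'f) alg" where
  "alg_B X r \<alpha> =
     central_ext (direct_sum (alg_A X r) (op_alg (alg_A X r))) (form_ext (form_f \<alpha>))"

definition star :: "('a \<times> 'a) \<times> 'f \<Rightarrow> ('a \<times> 'a) \<times> 'f::field" where
  "star = (\<lambda>((a, b), k). ((b, a), - k))"

definition phi :: "'a \<Rightarrow> ('a \<times> 'a) \<times> 'f::field" where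
  "phi a = ((a, a), 0)"


section \<open>Basic properties\<close>

text \<open>
  The facts below are not needed to state the theorem. They record that the products and the form
  are well defined, that \<open>A\<close> and \<open>B\<close> are associative algebras, and that \<open>\<phi>\<close> is a Jordan isomorphism
  of \<open>A\<close> onto the symmetric elements of \<open>B\<close>.
\<close>

subsection \<open>Bilinear extension\<close>

definition biadditive :: "('k \<Rightarrow> 'l \<Rightarrow> 'a::ab_group_add \<Rightarrow> 'b::ab_group_add \<Rightarrow> 'c::ab_group_add) \<Rightarrow> bool"
  where "biadditive K \<longleftrightarrow> (\<forall>u v x x' y y'. K u v (x + x') y = K u v x y + K u v x' y \<and>
     K u v x (y + y') = K u v x y + K u v x y')"

lemma biadditive_zero:
  assumes "biadditive K" shows "K u v 0 y = 0" "K u v x 0 = 0"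
proof -
  have "K u v (0 + 0) y = K u v 0 y + K u v 0 y" using assms unfolding biadditive_def by blast
  then show "K u v 0 y = 0" by simp
  have "K u v x (0 + 0) = K u v x 0 + K u v x 0" using assms unfolding biadditive_def by blast
  then show "K u v x 0 = 0" by simp
qed

lemma bilinear_ext_superset:
  assumes K: "biadditive K"
    and U: "finite U" "Poly_Mapping.keys a \<subseteq> U" and V: "finite V" "Poly_Mapping.keys b \<subseteq> V"
  shows "bilinear_ext K a b =
    (\<Sum>u\<in>U. \<Sum>v\<in>V. K u v (Poly_Mapping.lookup a u) (Poly_Mapping.lookup b v))"
proof -
  have "bilinear_ext K a b = (\<Sum>u\<in>Poly_Mapping.keys a. \<Sum>v\<in>V.
      K u v (Poly_Mapping.lookup a u) (Poly_Mapping.lookup b v))"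
    unfolding bilinear_ext_def
    by (intro sum.cong refl sum.mono_neutral_left V)
       (auto simp: in_keys_iff biadditive_zero[OF K])
  also have "\<dots> = (\<Sum>u\<in>U. \<Sum>v\<in>V. K u v (Poly_Mapping.lookup a u) (Poly_Mapping.lookup b v))"
    by (intro sum.mono_neutral_left U) (auto simp: in_keys_iff biadditive_zero[OF K])
  finally show ?thesis .
qed

lemma bilinear_ext_add:
  assumes K: "biadditive K"
  shows "bilinear_ext K (a + a') b = bilinear_ext K a b + bilinear_ext K a' b"
    and "bilinear_ext K a (b + b') = bilinear_ext K a b + bilinear_ext K a b'"
proof -
  let ?U = "Poly_Mapping.keys a \<union> Poly_Mapping.keys a'" and ?V = "Poly_Mapping.keys b \<union> Poly_Mapping.keys b'"
  have add: "K u v (x + x') y = K u v x y + K u v x' y"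
    "K u v x (y + y') = K u v x y + K u v x y'" for u v x x' y y'
    using K unfolding biadditive_def by blast+
  show "bilinear_ext K (a + a') b = bilinear_ext K a b + bilinear_ext K a' b"
    by (subst (1 2 3) bilinear_ext_superset[OF K, of ?U _ ?V])
       (use keys_add[of a a'] in \<open>auto simp: lookup_add add sum.distrib\<close>)
  show "bilinear_ext K a (b + b') = bilinear_ext K a b + bilinear_ext K a b'"
    by (subst (1 2 3) bilinear_ext_superset[OF K, of ?U _ ?V])
       (use keys_add[of b b'] in \<open>auto simp: lookup_add add sum.distrib\<close>)
qed

lemma bilinear_ext_0 [simp]: "bilinear_ext K 0 b = 0" "bilinear_ext K a 0 = 0"
  by (simp_all add: bilinear_ext_def)

lemma bilinear_ext_sum:
  assumes K: "biadditive K"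
  shows "bilinear_ext K (\<Sum>i\<in>I. a i) b = (\<Sum>i\<in>I. bilinear_ext K (a i) b)"
    and "bilinear_ext K d (\<Sum>i\<in>I. e i) = (\<Sum>i\<in>I. bilinear_ext K d (e i))"
  by (induction I rule: infinite_finite_induct; simp add: bilinear_ext_add[OF K])+

lemma bilinear_ext_single:
  assumes K: "biadditive K"
  shows "bilinear_ext K (Poly_Mapping.single u x) b =
      (\<Sum>v\<in>Poly_Mapping.keys b. K u v x (Poly_Mapping.lookup b v))"
    and "bilinear_ext K a (Poly_Mapping.single v y) =
      (\<Sum>u\<in>Poly_Mapping.keys a. K u v (Poly_Mapping.lookup a u) y)"
proof -
  show "bilinear_ext K (Poly_Mapping.single u x) b =
      (\<Sum>v\<in>Poly_Mapping.keys b. K u v x (Poly_Mapping.lookup b v))"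
    by (subst bilinear_ext_superset[OF K, of "{u}" _ "Poly_Mapping.keys b"]) auto
  show "bilinear_ext K a (Poly_Mapping.single v y) =
      (\<Sum>u\<in>Poly_Mapping.keys a. K u v (Poly_Mapping.lookup a u) y)"
    by (subst bilinear_ext_superset[OF K, of "Poly_Mapping.keys a" _ "{v}"]) auto
qed

lemma lookup_map0: "f 0 = 0 \<Longrightarrow> Poly_Mapping.lookup (Poly_Mapping.map f a) k = f (Poly_Mapping.lookup a k)"
  by (simp add: map.rep_eq when_def)

lemma keys_map0: "f 0 = 0 \<Longrightarrow> Poly_Mapping.keys (Poly_Mapping.map f a) \<subseteq> Poly_Mapping.keys a"
  by (auto simp: in_keys_iff lookup_map0)

lemma bilinear_ext_map:
  assumes K: "biadditive K" and s: "s 0 = 0" "\<And>x y. s (x + y) = s x + s y" 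
  shows "t 0 = 0 \<Longrightarrow> (\<And>u v x y. K u v (t x) y = s (K u v x y)) \<Longrightarrow>
        bilinear_ext K (Poly_Mapping.map t a) b = s (bilinear_ext K a b)"
    and "t' 0 = 0 \<Longrightarrow> (\<And>u v x y. K u v x (t' y) = s (K u v x y)) \<Longrightarrow>
        bilinear_ext K a (Poly_Mapping.map t' b) = s (bilinear_ext K a b)"
proof -
  have ssum: "s (sum h I) = (\<Sum>i\<in>I. s (h i))" for h and I :: "'z set"
    by (induction I rule: infinite_finite_induct) (auto simp: s)
  show "bilinear_ext K (Poly_Mapping.map t a) b = s (bilinear_ext K a b)"
    if "t 0 = 0" "\<And>u v x y. K u v (t x) y = s (K u v x y)"
    using that keys_map0[of t a]
    by (subst (1 2) bilinear_ext_superset[OF K, of "Poly_Mapping.keys a" _ "Poly_Mapping.keys b"])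
       (auto simp: lookup_map0 ssum)
  show "bilinear_ext K a (Poly_Mapping.map t' b) = s (bilinear_ext K a b)"
    if "t' 0 = 0" "\<And>u v x y. K u v x (t' y) = s (K u v x y)"
    using that keys_map0[of t' b]
    by (subst (1 2) bilinear_ext_superset[OF K, of "Poly_Mapping.keys a" _ "Poly_Mapping.keys b"])
       (auto simp: lookup_map0 ssum)
qed

lemma map_add0:
  assumes "f 0 = 0" "\<And>x y. f (x + y) = f x + f y"
  shows "Poly_Mapping.map f (a + b) = Poly_Mapping.map f a + Poly_Mapping.map f b"
  by (rule poly_mapping_eqI) (simp add: lookup_map0 lookup_add assms)

lemma map_zero [simp]: "Poly_Mapping.map f 0 = 0"
  by (rule poly_mapping_eqI) (simp add: map.rep_eq)

lemma map_single0: "f 0 = 0 \<Longrightarrow> Poly_Mapping.map f (Poly_Mapping.single k x) = Poly_Mapping.single k (f x)"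
  by (rule poly_mapping_eqI) (auto simp: lookup_map0 lookup_single when_def)


subsection \<open>Semigroup algebras\<close>

lemma sgrp_alg_biadditive:
  "biadditive (\<lambda>u v (x::'f::field) y. Poly_Mapping.single (sop S u v) (x * y))"
  by (simp add: biadditive_def single_add algebra_simps)

lemma assoc_alg_sgrp_alg:
  fixes S :: "'s sgrp"
  assumes closed: "\<And>u v. u \<in> selems S \<Longrightarrow> v \<in> selems S \<Longrightarrow> sop S u v \<in> selems S"
    and assoc: "\<And>u v w. u \<in> selems S \<Longrightarrow> v \<in> selems S \<Longrightarrow> w \<in> selems S \<Longrightarrow>
        sop S (sop S u v) w = sop S u (sop S v w)"
  shows "assoc_alg (sgrp_alg S :: ('f::field, _) alg)"
proof -
  let ?K = "\<lambda>u v (x::'f) y. Poly_Mapping.single (sop S u v) (x * y)"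
  note K = sgrp_alg_biadditive[where ?'f = 'f and S = S]
  have keys: "Poly_Mapping.keys (bilinear_ext ?K a b) \<subseteq> selems S"
    if "Poly_Mapping.keys a \<subseteq> selems S" "Poly_Mapping.keys b \<subseteq> selems S" for a b
    unfolding bilinear_ext_def
    using that by (intro order.trans[OF keys_sum] UN_least) (auto split: if_splits intro!: closed)
  have ass: "bilinear_ext ?K (bilinear_ext ?K a b) c = bilinear_ext ?K a (bilinear_ext ?K b c)"
    if "Poly_Mapping.keys a \<subseteq> selems S" "Poly_Mapping.keys b \<subseteq> selems S" "Poly_Mapping.keys c \<subseteq> selems S" for a b c
  proof -
    have "bilinear_ext ?K (bilinear_ext ?K a b) c =
      (\<Sum>u\<in>Poly_Mapping.keys a. \<Sum>v\<in>Poly_Mapping.keys b. \<Sum>w\<in>Poly_Mapping.keys c.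
        Poly_Mapping.single (sop S (sop S u v) w) (Poly_Mapping.lookup a u * Poly_Mapping.lookup b v * Poly_Mapping.lookup c w))"
      by (subst bilinear_ext_def[of ?K a b]) (simp add: bilinear_ext_sum[OF K] bilinear_ext_single[OF K])
    also have "\<dots> = (\<Sum>u\<in>Poly_Mapping.keys a. \<Sum>v\<in>Poly_Mapping.keys b. \<Sum>w\<in>Poly_Mapping.keys c.
        Poly_Mapping.single (sop S u (sop S v w)) (Poly_Mapping.lookup a u * (Poly_Mapping.lookup b v * Poly_Mapping.lookup c w)))"
      using that by (intro sum.cong refl) (simp add: assoc subset_iff mult.assoc)
    also have "\<dots> = (\<Sum>v\<in>Poly_Mapping.keys b. \<Sum>w\<in>Poly_Mapping.keys c. \<Sum>u\<in>Poly_Mapping.keys a. 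
        Poly_Mapping.single (sop S u (sop S v w)) (Poly_Mapping.lookup a u * (Poly_Mapping.lookup b v * Poly_Mapping.lookup c w)))"
      by (rule trans[OF sum.swap], rule sum.cong[OF refl], rule sum.swap)
    also have "\<dots> = bilinear_ext ?K a (bilinear_ext ?K b c)"
      by (subst bilinear_ext_def[of ?K b c]) (simp add: bilinear_ext_sum[OF K] bilinear_ext_single[OF K])
    finally show ?thesis .
  qed
  have sc: "Poly_Mapping.map ((*) c) (x + y) = Poly_Mapping.map ((*) c) x + Poly_Mapping.map ((*) c) y"
    for c :: 'f and x y :: "'s \<Rightarrow>\<^sub>0 'f"
    by (rule map_add0) (auto simp: algebra_simps)
  show ?thesis
    unfolding assoc_alg_def sgrp_alg_def alg.simps mem_Collect_eq
  proof (intro conjI ballI allI, goal_cases)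
    case (2 x y) then show ?case using keys_add[of x y] by auto
  next
    case (4 c x) then show ?case using keys_map0[of "(*) c" x] by auto
  next
    case (9 c x y) show ?case by (rule bilinear_ext_map[OF K])
      (auto simp: sc map_single0 mult.assoc)
  next
    case (10 c x y) show ?case by (rule bilinear_ext_map[OF K])
      (auto simp: sc map_single0 mult.left_commute)
  qed (auto simp: keys ass sc bilinear_ext_add[OF K] lookup_map0 lookup_add algebra_simps
            intro!: poly_mapping_eqI dest!: subsetD[OF keys])
qed


subsection \<open>Strictly upper triangular matrices\<close>

lemma strict_upper_biadditive:
  assumes "\<And>x y z. mult R (x + y) z = mult R x z + mult R y z"
    and "\<And>x y z. mult R x (y + z) = mult R x y + mult R x z"
  shows "biadditive (\<lambda>(i, j) (p, q) a b.
    if j = p then Poly_Mapping.single (i :: nat, q :: nat) (mult R a b) else 0)"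
  by (auto simp: biadditive_def assms single_add)

lemma assoc_alg_strict_upper:
  fixes R :: "('f::field, 'r::ab_group_add) alg"
  assumes R: "assoc_alg R"
    and add: "\<And>x y z. mult R (x + y) z = mult R x z + mult R y z"
      "\<And>x y z. mult R x (y + z) = mult R x y + mult R x z"
    and sc: "\<And>c x y. scale R c (x + y) = scale R c x + scale R c y"
      "\<And>c x y. mult R (scale R c x) y = scale R c (mult R x y)"
      "\<And>c x y. mult R x (scale R c y) = scale R c (mult R x y)"
  shows "assoc_alg (strict_upper R)"
proof -
  define K where "K = (\<lambda>(i, j) (p :: nat, q) a b.
    if j = p then Poly_Mapping.single (i :: nat, q :: nat) (mult R a b) else 0)"
  have K: "biadditive K" unfolding K_def by (rule strict_upper_biadditive[of R, OF add])
  have K_eq: "K u v x y = (if snd u = fst v then Poly_Mapping.single (fst u, snd v) (mult R x y) else 0)"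
    for u v x y by (simp add: K_def case_prod_beta)
  define D where "D m \<longleftrightarrow> (\<forall>(i, j)\<in>Poly_Mapping.keys m.
      1 \<le> i \<and> i < j \<and> Poly_Mapping.lookup m (i, j) \<in> carr R)" for m :: "(nat \<times> nat) \<Rightarrow>\<^sub>0 'r"
  have R0: "0 \<in> carr R" and Radd: "\<And>x y. x \<in> carr R \<Longrightarrow> y \<in> carr R \<Longrightarrow> x + y \<in> carr R"
    and Rm: "\<And>x y. x \<in> carr R \<Longrightarrow> y \<in> carr R \<Longrightarrow> mult R x y \<in> carr R"
    and Rs: "\<And>c x. x \<in> carr R \<Longrightarrow> scale R c x \<in> carr R"
    and R1: "\<And>x. x \<in> carr R \<Longrightarrow> scale R 1 x = x"
    and R2: "\<And>c d x. x \<in> carr R \<Longrightarrow> scale R (c + d) x = scale R c x + scale R d x"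
    and R3: "\<And>c d x. x \<in> carr R \<Longrightarrow> scale R (c * d) x = scale R c (scale R d x)"
    and Rass: "\<And>x y z. x \<in> carr R \<Longrightarrow> y \<in> carr R \<Longrightarrow> z \<in> carr R \<Longrightarrow>
       mult R (mult R x y) z = mult R x (mult R y z)"
    using R unfolding assoc_alg_def by blast+
  have sc0: "scale R c 0 = 0" for c using sc(1)[of c 0 0] by simp
  have m0: "mult R 0 x = 0" "mult R x 0 = 0" for x
    using add(1)[of 0 0 x] add(2)[of x 0 0] by simp_all
  have Diff: "D m \<longleftrightarrow> (\<forall>i j. (1 \<le> i \<and> i < j \<and> Poly_Mapping.lookup m (i, j) \<in> carr R) \<or>
       Poly_Mapping.lookup m (i, j) = 0)" for m
    unfolding D_def by (auto simp: in_keys_iff)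
  have DI: "Poly_Mapping.lookup m p \<in> carr R" if "D m" for m p
    using that R0 by (cases p) (metis Diff)
  have D0: "D 0" by (simp add: D_def)
  have Dadd: "D (m + n)" if "D m" "D n" for m n
    using that R0 unfolding Diff lookup_add by (metis add_0 add_0_right Radd)
  have Dsum: "D (sum h I)" if "\<And>i. i \<in> I \<Longrightarrow> D (h i)" for h and I :: "'z set"
    using that by (induction I rule: infinite_finite_induct) (auto simp: D0 Dadd)
  have Dmult: "D (bilinear_ext K m n)" if "D m" "D n" for m n
    unfolding bilinear_ext_def
  proof (intro Dsum, safe)
    fix i j p q assume "(i, j) \<in> Poly_Mapping.keys m" "(p, q) \<in> Poly_Mapping.keys n"
    then have "1 \<le> i" "i < j" "p < q" using that unfolding D_def by auto
    then show "D (K (i, j) (p, q) (Poly_Mapping.lookup m (i, j)) (Poly_Mapping.lookup n (p, q)))"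
      using DI[OF that(1)] DI[OF that(2)] by (auto simp: D_def K_eq Rm split: if_splits)
  qed
  have ass: "bilinear_ext K (bilinear_ext K a b) c = bilinear_ext K a (bilinear_ext K b c)"
    if "D a" "D b" "D c" for a b c
  proof -
    have "bilinear_ext K (bilinear_ext K a b) c =
      (\<Sum>u\<in>Poly_Mapping.keys a. \<Sum>v\<in>Poly_Mapping.keys b. \<Sum>w\<in>Poly_Mapping.keys c.
        if snd u = fst v \<and> snd v = fst w then Poly_Mapping.single (fst u, snd w)
          (mult R (mult R (Poly_Mapping.lookup a u) (Poly_Mapping.lookup b v)) (Poly_Mapping.lookup c w)) else 0)"
      by (subst bilinear_ext_def[of K a b])
         (auto simp: bilinear_ext_sum[OF K] bilinear_ext_single[OF K] K_eq m0 intro!: sum.cong)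
    also have "\<dots> = (\<Sum>u\<in>Poly_Mapping.keys a. \<Sum>v\<in>Poly_Mapping.keys b. \<Sum>w\<in>Poly_Mapping.keys c.
        if snd u = fst v \<and> snd v = fst w then Poly_Mapping.single (fst u, snd w)
          (mult R (Poly_Mapping.lookup a u) (mult R (Poly_Mapping.lookup b v) (Poly_Mapping.lookup c w))) else 0)"
      using that by (intro sum.cong refl) (simp add: Rass DI)
    also have "\<dots> = (\<Sum>v\<in>Poly_Mapping.keys b. \<Sum>w\<in>Poly_Mapping.keys c. \<Sum>u\<in>Poly_Mapping.keys a. 
        if snd u = fst v \<and> snd v = fst w then Poly_Mapping.single (fst u, snd w)
          (mult R (Poly_Mapping.lookup a u) (mult R (Poly_Mapping.lookup b v) (Poly_Mapping.lookup c w))) else 0)"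
      by (rule trans[OF sum.swap], rule sum.cong[OF refl], rule sum.swap)
    also have "\<dots> = bilinear_ext K a (bilinear_ext K b c)"
      by (subst bilinear_ext_def[of K b c])
         (auto simp: bilinear_ext_sum[OF K] bilinear_ext_single[OF K] K_eq m0 intro!: sum.cong)
    finally show ?thesis .
  qed
  have msc: "Poly_Mapping.map (scale R c) (x + y) = Poly_Mapping.map (scale R c) x + Poly_Mapping.map (scale R c) y"
    for c and x y :: "(nat \<times> nat) \<Rightarrow>\<^sub>0 'r"
    by (rule map_add0) (auto simp: sc sc0)
  show ?thesis
    unfolding assoc_alg_def strict_upper_def K_def[symmetric] alg.simps mem_Collect_eq D_def[symmetric]
  proof (intro conjI ballI allI, goal_cases)
    case (4 c x) have "D (Poly_Mapping.map (scale R c) x)"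
      unfolding Diff lookup_map0[of "scale R c", OF sc0]
    proof (intro allI)
      fix i j
      have "(1 \<le> i \<and> i < j \<and> Poly_Mapping.lookup x (i, j) \<in> carr R) \<or> Poly_Mapping.lookup x (i, j) = 0"
        using 4 unfolding Diff by blast
      then show "(1 \<le> i \<and> i < j \<and> scale R c (Poly_Mapping.lookup x (i, j)) \<in> carr R) \<or>
          scale R c (Poly_Mapping.lookup x (i, j)) = 0"
        using Rs[of _ c] by (elim disjE) (simp_all add: sc0)
    qed
    then show ?case .
  next
    case (9 c x y) show ?case by (rule bilinear_ext_map[OF K])
      (auto simp: msc map_single0 sc sc0 K_eq)
  next
    case (10 c x y) show ?case by (rule bilinear_ext_map[OF K])
      (auto simp: msc map_single0 sc sc0 K_eq)
  qed (auto simp: D0 Dadd Dmult ass msc bilinear_ext_add[OF K] lookup_map0 lookup_add DI sc0 R1 R2 R3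
            intro!: poly_mapping_eqI)
qed


subsection \<open>The semigroup and its cocycle\<close>

context
  fixes X :: "'x set" and r
  assumes cong: "congruence X r"
begin

lemma congruence_append: "(u, u') \<in> r \<Longrightarrow> (v, v') \<in> r \<Longrightarrow> (u @ v, u' @ v') \<in> r"
  using cong unfolding congruence_def by blast

lemma congruence_equiv: "equiv (words X) r"
  using cong unfolding congruence_def by blast

lemma words_append:
  "u \<in> words X \<Longrightarrow> v \<in> words X \<Longrightarrow> u @ v \<in> words X"
  by (auto simp: words_def)

lemma quotient_sgrp_sop:
  assumes "u \<in> words X" "v \<in> words X"
  shows "sop (quotient_sgrp X r) (r `` {u}) (r `` {v}) = r `` {u @ v}"
proof -
  have "r `` {u' @ v'} = r `` {u @ v}" if "(u, u') \<in> r" "(v, v') \<in> r" for u' v'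
    using equiv_class_eq[OF congruence_equiv congruence_append[OF that]] by simp
  moreover have "(u, u) \<in> r" "(v, v) \<in> r"
    using assms congruence_equiv by (auto simp: equiv_def refl_on_def)
  ultimately have "(\<Union>u'\<in>r `` {u}. \<Union>v'\<in>r `` {v}. r `` {u' @ v'}) = r `` {u @ v}"
    by (intro equalityI subsetI) blast+
  then show ?thesis by (simp only: quotient_sgrp_def sgrp.simps)
qed

lemma quotient_sgrp_semigroup:
  defines "S \<equiv> quotient_sgrp X r"
  assumes "a \<in> selems S" "b \<in> selems S"
  shows "sop S a b \<in> selems S"
    and "c \<in> selems S \<Longrightarrow> sop S (sop S a b) c = sop S a (sop S b c)"
proof -
  from assms obtain u v where uv: "u \<in> words X" "v \<in> words X" "a = r `` {u}" "b = r `` {v}"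
    unfolding quotient_sgrp_def by (auto elim!: quotientE)
  then show "sop S a b \<in> selems S"
    unfolding S_def by (simp add: quotient_sgrp_sop)
      (simp add: quotient_sgrp_def words_append quotientI)
  assume "c \<in> selems S"
  then obtain w where w: "w \<in> words X" "c = r `` {w}"
    unfolding S_def quotient_sgrp_def by (auto elim!: quotientE)
  note q = quotient_sgrp_sop
  show "sop S (sop S a b) c = sop S a (sop S b c)"
    unfolding S_def uv(3,4) w(2) q[OF uv(1,2)] q[OF uv(2) w(1)]
      q[OF words_append[OF uv(1,2)] w(1)] q[OF uv(1) words_append[OF uv(2) w(1)]] append_assoc ..
qed

end

lemma congruence_cong_closure:
  assumes "\<sigma> \<subseteq> words X \<times> words X"
  shows "congruence X (cong_closure X \<sigma>)" and "\<sigma> \<subseteq> cong_closure X \<sigma>"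
proof -
  have "congruence X (words X \<times> words X)"
    unfolding congruence_def equiv_def
  proof (intro conjI allI impI)
    show "refl_on (words X) (words X \<times> words X)" by (simp add: refl_on_def)
    show "sym (words X \<times> words X)" by (rule symI) simp
    show "trans (words X \<times> words X)" by (rule transI) simp
  qed (auto simp: words_def)
  then have full: "words X \<times> words X \<in> {r. congruence X r \<and> \<sigma> \<subseteq> r}" using assms by auto
  show "congruence X (cong_closure X \<sigma>)"
    unfolding congruence_def equiv_def
  proof (intro conjI allI impI)
    show "cong_closure X \<sigma> \<subseteq> words X \<times> words X"
      using full unfolding cong_closure_def by blast
    show "refl_on (words X) (cong_closure X \<sigma>)"
      by (auto simp: cong_closure_def refl_on_def congruence_def equiv_def)
    show "sym (cong_closure X \<sigma>)"
      by (auto simp: cong_closure_def congruence_def equiv_def intro!: symI dest: symD)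
    show "trans (cong_closure X \<sigma>)"
    proof (rule transI)
      fix u v w assume uv: "(u, v) \<in> cong_closure X \<sigma>" and vw: "(v, w) \<in> cong_closure X \<sigma>"
      show "(u, w) \<in> cong_closure X \<sigma>"
        unfolding cong_closure_def
      proof (rule InterI)
        fix r assume r: "r \<in> {r. congruence X r \<and> \<sigma> \<subseteq> r}"
        then have "(u, v) \<in> r" "(v, w) \<in> r" using uv vw unfolding cong_closure_def by blast+
        moreover have "trans r" using r by (auto simp: congruence_def equiv_def)
        ultimately show "(u, w) \<in> r" by (meson transD)
      qed
    qed
    fix u1 v1 u2 v2 assume "(u1, v1) \<in> cong_closure X \<sigma>" "(u2, v2) \<in> cong_closure X \<sigma>"
    then show "(u1 @ u2, v1 @ v2) \<in> cong_closure X \<sigma>"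
      unfolding cong_closure_def using congruence_append[of X _ u1 v1 u2 v2] by simp
  qed
  show "\<sigma> \<subseteq> cong_closure X \<sigma>" unfolding cong_closure_def by blast
qed

context
  fixes X :: "'x set" and r and \<alpha> :: "'x list \<Rightarrow> 'f::field"
  assumes graded: "graded_congruence X r"
    and \<alpha>: "\<forall>u\<in>words X. \<forall>v\<in>words X. \<alpha> u = \<alpha> v \<longleftrightarrow> (u, v) \<in> sim_in X r"
begin

lemma graded_cong: "congruence X r"
  using graded by (simp add: graded_congruence_def)

lemma alpha_well_defined:
  assumes "(u, u') \<in> r" "(v, v') \<in> r"
  shows "\<alpha> (u @ v) = \<alpha> (u' @ v')"
proof -
  let ?s = "{(u', v') \<in> r. length u' = length v' \<and> length u' < length (u @ v)}"
  have len: "length u = length u'" "length v = length v'"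
    using assms graded unfolding graded_congruence_def by auto
  have w: "u \<in> words X" "v \<in> words X" "u' \<in> words X" "v' \<in> words X"
    using assms congruence_equiv[OF graded_cong] unfolding equiv_def by auto
  have s: "?s \<subseteq> words X \<times> words X"
    using congruence_equiv[OF graded_cong] unfolding equiv_def by auto
  have "(u, u') \<in> ?s" "(v, v') \<in> ?s"
    using assms len w by (auto simp: words_def)
  then have "(u @ v, u' @ v') \<in> cong_closure X ?s"
    
    by (intro congruence_append[OF congruence_cong_closure(1)[OF s]] subsetD[OF congruence_cong_closure(2)[OF s]])
  then have "(u @ v, u' @ v') \<in> sim_in X r"
    unfolding sim_in_def using len w by (auto simp: words_def)
  then show ?thesis using \<alpha> w words_append[OF graded_cong] by blast
qed

lemma form_h_class:
  assumes "u \<in> words X" "v \<in> words X"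
  shows "form_h \<alpha> (r `` {u}) (r `` {v}) = \<alpha> (u @ v)"
proof -
  have "(u, u) \<in> r" "(v, v) \<in> r"
    using assms congruence_equiv[OF graded_cong] by (auto simp: equiv_def refl_on_def)
  moreover have "\<alpha> (u' @ v') = \<alpha> (u @ v)" if "u' \<in> r `` {u}" "v' \<in> r `` {v}" for u' v'
    using that alpha_well_defined[of u u' v v'] by simp
  ultimately have "(\<Union>u'\<in>r `` {u}. \<Union>v'\<in>r `` {v}. {\<alpha> (u' @ v')}) = {\<alpha> (u @ v)}"
    by (intro equalityI subsetI) blast+
  then show ?thesis by (simp add: form_h_def)
qed

lemma form_h_assoc:
  defines "S \<equiv> quotient_sgrp X r"
  assumes "a \<in> selems S" "b \<in> selems S" "c \<in> selems S"
  shows "form_h \<alpha> (sop S a b) c = form_h \<alpha> a (sop S b c)"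
proof -
  from assms obtain u v w where uvw: "u \<in> words X" "v \<in> words X" "w \<in> words X"
    "a = r `` {u}" "b = r `` {v}" "c = r `` {w}"
    unfolding quotient_sgrp_def by (auto elim!: quotientE)
  note q = quotient_sgrp_sop[OF graded_cong] and w = words_append[OF graded_cong]
  show ?thesis
    unfolding S_def uvw(4-6) q[OF uvw(1,2)] q[OF uvw(2,3)]
      form_h_class[OF w[OF uvw(1,2)] uvw(3)] form_h_class[OF uvw(1) w[OF uvw(2,3)]] append_assoc ..
qed


subsection \<open>The algebra \<open>A\<close> and the form\<close>

private abbreviation (input) "FS \<equiv> sgrp_alg (quotient_sgrp X r) :: ('f, 'x list set \<Rightarrow>\<^sub>0 'f) alg"
private abbreviation (input) "AA \<equiv> alg_A X r :: ('f, ('x list set, 'f) mat) alg"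

lemma assoc_alg_FS: "assoc_alg FS"
  by (rule assoc_alg_sgrp_alg) (use quotient_sgrp_semigroup[OF graded_cong] in blast)+

lemma FS_global:
  "mult FS (x + y) z = mult FS x z + mult FS y z"
  "mult FS x (y + z) = mult FS x y + mult FS x z"
  "scale FS c (x + y) = scale FS c x + scale FS c y"
  "mult FS (scale FS c x) y = scale FS c (mult FS x y)"
  "mult FS x (scale FS c y) = scale FS c (mult FS x y)"
proof -
  note K = sgrp_alg_biadditive[where ?'f = 'f and S = "quotient_sgrp X r"]
  have sc: "Poly_Mapping.map ((*) c) (x + y) = Poly_Mapping.map ((*) c) x + Poly_Mapping.map ((*) c) y"
    for c :: 'f and x y :: "'x list set \<Rightarrow>\<^sub>0 'f"
    by (rule map_add0) (auto simp: algebra_simps)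
  then show "scale FS c (x + y) = scale FS c x + scale FS c y"
    by (simp add: sgrp_alg_def)
  show "mult FS (x + y) z = mult FS x z + mult FS y z"
    "mult FS x (y + z) = mult FS x y + mult FS x z"
    by (simp_all add: sgrp_alg_def bilinear_ext_add[OF K])
  show "mult FS (scale FS c x) y = scale FS c (mult FS x y)"
    unfolding sgrp_alg_def alg.simps
    by (rule bilinear_ext_map[OF K]) (auto simp: sc map_single0 mult.assoc)
  show "mult FS x (scale FS c y) = scale FS c (mult FS x y)"
    unfolding sgrp_alg_def alg.simps
    by (rule bilinear_ext_map[OF K]) (auto simp: sc map_single0 mult.left_commute)
qed

lemma assoc_alg_A: "assoc_alg AA"
  unfolding alg_A_def by (rule assoc_alg_strict_upper[OF assoc_alg_FS]) (rule FS_global)+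

private abbreviation (input) "entry_form \<equiv> bilinear_ext (\<lambda>u v (x::'f) y. x * y * form_h \<alpha> u v)"

lemma entry_form_biadditive: "biadditive (\<lambda>u v (x::'f) y. x * y * form_h \<alpha> u v)"
  by (simp add: biadditive_def algebra_simps)

lemma entry_form_assoc:
  assumes "a \<in> carr FS" "b \<in> carr FS" "c \<in> carr FS"
  shows "entry_form (mult FS a b) c = entry_form a (mult FS b c)"
proof -
  let ?S = "quotient_sgrp X r"
  note K = sgrp_alg_biadditive[where ?'f = 'f and S = ?S]
  note H = entry_form_biadditive
  have sub: "Poly_Mapping.keys a \<subseteq> selems ?S" "Poly_Mapping.keys b \<subseteq> selems ?S" "Poly_Mapping.keys c \<subseteq> selems ?S"
    using assms by (auto simp: sgrp_alg_def)
  have "entry_form (mult FS a b) c =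
    (\<Sum>u\<in>Poly_Mapping.keys a. \<Sum>v\<in>Poly_Mapping.keys b. \<Sum>w\<in>Poly_Mapping.keys c.
      Poly_Mapping.lookup a u * Poly_Mapping.lookup b v * Poly_Mapping.lookup c w * form_h \<alpha> (sop ?S u v) w)"
    unfolding sgrp_alg_def alg.simps
    by (subst bilinear_ext_def[of _ a b]) (simp add: bilinear_ext_sum[OF H] bilinear_ext_single[OF H])
  also have "\<dots> = (\<Sum>u\<in>Poly_Mapping.keys a. \<Sum>v\<in>Poly_Mapping.keys b. \<Sum>w\<in>Poly_Mapping.keys c.
      Poly_Mapping.lookup a u * (Poly_Mapping.lookup b v * Poly_Mapping.lookup c w) * form_h \<alpha> u (sop ?S v w))"
    using sub by (intro sum.cong refl) (simp add: form_h_assoc subset_iff mult.assoc)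
  also have "\<dots> = (\<Sum>v\<in>Poly_Mapping.keys b. \<Sum>w\<in>Poly_Mapping.keys c. \<Sum>u\<in>Poly_Mapping.keys a.
      Poly_Mapping.lookup a u * (Poly_Mapping.lookup b v * Poly_Mapping.lookup c w) * form_h \<alpha> u (sop ?S v w))"
    by (rule trans[OF sum.swap], rule sum.cong[OF refl], rule sum.swap)
  also have "\<dots> = entry_form a (mult FS b c)"
    unfolding sgrp_alg_def alg.simps
    by (subst bilinear_ext_def[of _ b c]) (simp add: bilinear_ext_sum[OF H] bilinear_ext_single[OF H])
  finally show ?thesis .
qed

lemma form_f_biadditive:
  "biadditive (\<lambda>(i::nat, j::nat) (p::nat, q::nat) a b. if j = p then entry_form a b else 0)"
  by (auto simp: biadditive_def bilinear_ext_add[OF entry_form_biadditive])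

lemma entry_form_scale:
  "entry_form (Poly_Mapping.map ((*) c) a) b = c * entry_form a b"
  "entry_form a (Poly_Mapping.map ((*) c) b) = c * entry_form a b"
  by (rule bilinear_ext_map[OF entry_form_biadditive]; simp add: algebra_simps)+

lemma form_f_linear:
  "form_f \<alpha> (a + a') b = form_f \<alpha> a b + form_f \<alpha> a' b"
  "form_f \<alpha> a (b + b') = form_f \<alpha> a b + form_f \<alpha> a b'"
  "form_f \<alpha> (scale AA c a) b = c * form_f \<alpha> a b"
  "form_f \<alpha> a (scale AA c b) = c * form_f \<alpha> a b"
proof -
  have scA: "scale AA c = Poly_Mapping.map (Poly_Mapping.map ((*) c))"
    by (simp add: alg_A_def strict_upper_def sgrp_alg_def)
  show "form_f \<alpha> (a + a') b = form_f \<alpha> a b + form_f \<alpha> a' b"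
    "form_f \<alpha> a (b + b') = form_f \<alpha> a b + form_f \<alpha> a b'"
    unfolding form_f_def by (simp_all only: bilinear_ext_add[OF form_f_biadditive])
  show "form_f \<alpha> (scale AA c a) b = c * form_f \<alpha> a b"
    unfolding form_f_def scA
    by (rule bilinear_ext_map[OF form_f_biadditive])
       (auto simp: distrib_left entry_form_scale simp del: mult.assoc)
  show "form_f \<alpha> a (scale AA c b) = c * form_f \<alpha> a b"
    unfolding form_f_def scA
    by (rule bilinear_ext_map[OF form_f_biadditive])
       (auto simp: distrib_left entry_form_scale simp del: mult.assoc)
qed

lemma form_f_assoc:
  assumes "a \<in> carr AA" "b \<in> carr AA" "c \<in> carr AA"
  shows "form_f \<alpha> (mult AA a b) c = form_f \<alpha> a (mult AA b c)"
proof -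
  define K where "K = (\<lambda>(i, j) (p :: nat, q) a b.
    if j = p then Poly_Mapping.single (i :: nat, q :: nat) (mult FS a b) else 0)"
  define H where "H = (\<lambda>(i::nat, j::nat) (p::nat, q::nat) a b. if j = p then entry_form a b else 0)"
  have K: "biadditive K" unfolding K_def by (rule strict_upper_biadditive) (rule FS_global)+
  have H: "biadditive H" unfolding H_def by (rule form_f_biadditive)
  have K_eq: "K u v x y = (if snd u = fst v then Poly_Mapping.single (fst u, snd v) (mult FS x y) else 0)"
    for u v x y by (simp add: K_def case_prod_beta)
  have H_eq: "H u v x y = (if snd u = fst v then entry_form x y else 0)"
    for u v x y by (simp add: H_def case_prod_beta)
  have mA: "mult AA = bilinear_ext K" and f: "form_f \<alpha> = bilinear_ext H"
    by (simp_all add: alg_A_def strict_upper_def form_f_def K_def H_def)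
  have in_FS: "Poly_Mapping.lookup m p \<in> carr FS" if "m \<in> carr AA" for m p
    using that by (cases "p \<in> Poly_Mapping.keys m")
      (auto simp: alg_A_def strict_upper_def sgrp_alg_def in_keys_iff case_prod_beta)
  have "form_f \<alpha> (mult AA a b) c =
    (\<Sum>u\<in>Poly_Mapping.keys a. \<Sum>v\<in>Poly_Mapping.keys b. \<Sum>w\<in>Poly_Mapping.keys c.
      if snd u = fst v \<and> snd v = fst w then
        entry_form (mult FS (Poly_Mapping.lookup a u) (Poly_Mapping.lookup b v)) (Poly_Mapping.lookup c w) else 0)"
    unfolding mA f
    by (subst bilinear_ext_def[of K a b])
       (auto simp: bilinear_ext_sum[OF H] bilinear_ext_single[OF H] K_eq H_eq intro!: sum.cong)
  also have "\<dots> = (\<Sum>u\<in>Poly_Mapping.keys a. \<Sum>v\<in>Poly_Mapping.keys b. \<Sum>w\<in>Poly_Mapping.keys c.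
      if snd u = fst v \<and> snd v = fst w then
        entry_form (Poly_Mapping.lookup a u) (mult FS (Poly_Mapping.lookup b v) (Poly_Mapping.lookup c w)) else 0)"
    using assms by (intro sum.cong refl) (simp add: entry_form_assoc in_FS)
  also have "\<dots> = (\<Sum>v\<in>Poly_Mapping.keys b. \<Sum>w\<in>Poly_Mapping.keys c. \<Sum>u\<in>Poly_Mapping.keys a.
      if snd u = fst v \<and> snd v = fst w then
        entry_form (Poly_Mapping.lookup a u) (mult FS (Poly_Mapping.lookup b v) (Poly_Mapping.lookup c w)) else 0)"
    by (rule trans[OF sum.swap], rule sum.cong[OF refl], rule sum.swap)
  also have "\<dots> = form_f \<alpha> a (mult AA b c)"
    unfolding mA f
    by (subst bilinear_ext_def[of K b c])
       (auto simp: bilinear_ext_sum[OF H] bilinear_ext_single[OF H] K_eq H_eq intro!: sum.cong)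
  finally show ?thesis .
qed


subsection \<open>The algebra \<open>B\<close>, its involution and the Jordan isomorphism\<close>

lemma assoc_alg_B: "assoc_alg (alg_B X r \<alpha>)"
  using assoc_alg_A
  unfolding assoc_alg_def alg_B_def central_ext_def direct_sum_def op_alg_def form_ext_def
  by (auto simp: form_f_linear form_f_assoc zero_prod_def algebra_simps)

lemma star_involution: "is_involution (alg_B X r \<alpha>) star"
  unfolding is_involution_def alg_antihom_def linear_map_def alg_B_def central_ext_def
    direct_sum_def op_alg_def form_ext_def star_def
  by auto

lemma phi_jordan_hom: "jordan_hom AA (alg_B X r \<alpha>) phi"
  using assoc_alg_A
  unfolding jordan_hom_def jprod_def linear_map_def alg_B_def central_ext_def
    direct_sum_def op_alg_def form_ext_def phi_def assoc_alg_def
  by (auto simp: algebra_simps)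

lemma phi_bij:
  assumes "CHAR('f) \<noteq> 2"
  shows "bij_betw phi (carr AA) (hermitian (alg_B X r \<alpha>) star)"
proof -
  have neg0: "k = 0" if "- k = k" for k :: 'f
  proof -
    have "k + k = 0" using that by (metis add.right_inverse)
    then have "of_nat 2 * k = 0" by (simp only: of_nat_numeral mult_2)
    moreover have "of_nat 2 \<noteq> (0 :: 'f)"
    proof
      assume "of_nat 2 = (0 :: 'f)"
      then have dvd: "CHAR('f) dvd 2" by (simp only: of_nat_eq_0_iff_char_dvd)
      then have "CHAR('f) \<le> 2" by (rule dvd_imp_le) simp
      moreover have "CHAR('f) \<noteq> 0" using dvd by (metis dvd_0_left zero_neq_numeral)
      ultimately show False using assms CHAR_not_1[where ?'a = 'f] by linarith
    qed
    ultimately show ?thesis by simp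
  qed
  have neg: "- k = k \<longleftrightarrow> k = 0" for k :: 'f using neg0[of k] minus_zero by blast
  show ?thesis
    unfolding bij_betw_def hermitian_def alg_B_def central_ext_def direct_sum_def op_alg_def
      star_def phi_def inj_on_def by (auto simp: image_iff neg)
qed

lemma phi_jordan_hom_verbal: "jordan_hom (verbal P AA) (alg_B X r \<alpha>) phi"
proof -
  have zero: "0 \<in> carr AA" and scale: "\<And>c x. x \<in> carr AA \<Longrightarrow> scale AA c x \<in> carr AA"
    and add: "\<And>x y. x \<in> carr AA \<Longrightarrow> y \<in> carr AA \<Longrightarrow> x + y \<in> carr AA"
    and mult: "\<And>x y. x \<in> carr AA \<Longrightarrow> y \<in> carr AA \<Longrightarrow> mult AA x y \<in> carr AA"
    using assoc_alg_A unfolding assoc_alg_def by blast+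
  have word: "word_prod AA xs \<in> carr AA" if "set xs \<subseteq> carr AA" for xs
    using that by (induction AA xs rule: word_prod.induct) (auto simp: zero mult)
  have "(\<Sum>i\<in>I. h i) \<in> carr AA" if "\<And>i. i \<in> I \<Longrightarrow> h i \<in> carr AA" for h and I :: "nat list set"
    using that by (induction I rule: infinite_finite_induct) (auto simp: zero add)
  then have sum: "\<And>I h. (\<And>i. i \<in> I \<Longrightarrow> h i \<in> carr AA) \<Longrightarrow> (\<Sum>i\<in>(I :: nat list set). h i) \<in> carr AA" .
  have "eval_at AA s p \<in> carr AA" if s: "range s \<subseteq> carr AA" for s p
    unfolding eval_at_def
  proof (intro sum scale word)
    fix w show "set (map s w) \<subseteq> carr AA" using s by auto
  qed
  then have sub: "x \<in> carr AA" if "x \<in> values_on P AA" for x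
    using that unfolding values_on_def by blast
  have eqs: "carr (verbal P AA) = values_on P AA" "scale (verbal P AA) = scale AA"
    "mult (verbal P AA) = mult AA"
    by (simp_all add: verbal_def)
  show ?thesis
    using phi_jordan_hom sub unfolding jordan_hom_def linear_map_def jprod_def eqs by blast
qed

end

end

theory Submission
  imports Defs
begin

text \<open>
  Matrix units \<open>e\<^sub>i\<^sub>k(u)\<close> with \<open>u\<close> long and \<open>k - i\<close> large all lie in \<open>P(A)\<close>. If \<open>\<phi> = \<psi>1 + \<psi>2\<close> on \<open>P(A)\<close>,
  apply \<open>\<phi>(x)\<phi>(y) = \<psi>1(xy) + \<psi>2(yx)\<close> to \<open>x = e\<^sub>i\<^sub>j(u)\<close>, \<open>y = e\<^sub>j\<^sub>k(v)\<close>: since \<open>yx = 0\<close>,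
  it gives \<open>\<psi>1(e\<^sub>i\<^sub>k(uv)) = e\<^sub>i\<^sub>k(uv) + \<alpha>(uv)z\<close>. As the left side depends only on the class of \<open>uv\<close>,
  the map \<open>\<alpha>\<close> is constant on the classes of long words. So every relation between long words
  follows from shorter ones, and the semigroup is finitely presented.
\<close>

section \<open>Renaming the alphabet\<close>

abbreviation rename_rel :: "('x \<Rightarrow> 'y) \<Rightarrow> ('x list \<times> 'x list) set \<Rightarrow> ('y list \<times> 'y list) set" where
  "rename_rel e r \<equiv> map_prod (map e) (map e) ` r"

lemma words_image: "words (e ` X) = map e ` words X"
proof
  show "words (e ` X) \<subseteq> map e ` words X"
  proof
    fix w assume "w \<in> words (e ` X)"
    then have w: "w \<noteq> []" "w \<in> lists (e ` X)" by (auto simp: words_def)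
    from w(2) obtain v where "v \<in> lists X" "w = map e v" unfolding lists_image by blast
    with w(1) show "w \<in> map e ` words X" by (auto simp: words_def)
  qed
qed (auto simp: words_def subset_iff)

lemma inj_on_map_words: "inj_on e X \<Longrightarrow> inj_on (map e) (words X)"
  by (rule inj_on_mapI, erule inj_on_subset) (auto simp: words_def)

lemma congruence_words: "congruence X r \<Longrightarrow> (u, v) \<in> r \<Longrightarrow> u \<in> words X \<and> v \<in> words X"
  by (auto simp: congruence_def equiv_def)

text \<open>Injectivity on the alphabet serves transitivity: two renamed pairs that share a middle
  word come from pairs of \<open>r\<close> that share theirs.\<close>

lemma congruence_rename:
  assumes r: "congruence X r" and e: "inj_on e X"
  shows "congruence (e ` X) (rename_rel e r)"
proof -
  have eq: "u = v" if "map e u = map e v" "u \<in> words X" "v \<in> words X" for u v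
    using inj_onD[OF inj_on_map_words[OF e]] that by blast
  have I: "(map e u, map e v) \<in> rename_rel e r" if "(u, v) \<in> r" for u v
    using imageI[OF that, of "map_prod (map e) (map e)"] by simp
  have E: thesis if "(x, y) \<in> rename_rel e r"
    "\<And>u v. (u, v) \<in> r \<Longrightarrow> x = map e u \<Longrightarrow> y = map e v \<Longrightarrow> thesis" for x y thesis
    using that by (auto simp: map_prod_def)
  have w: "u \<in> words X" "v \<in> words X" if "(u, v) \<in> r" for u v
    using congruence_words[OF r that] by auto
  have refl: "\<And>u. u \<in> words X \<Longrightarrow> (u, u) \<in> r" and sym: "\<And>u v. (u, v) \<in> r \<Longrightarrow> (v, u) \<in> r"
    and trans: "\<And>u v w. (u, v) \<in> r \<Longrightarrow> (v, w) \<in> r \<Longrightarrow> (u, w) \<in> r"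
    using congruence_equiv[OF r] unfolding equiv_def refl_on_def
    by (blast dest: symD transD)+
  show ?thesis
    unfolding congruence_def equiv_def
  proof (intro conjI allI impI)
    show "rename_rel e r \<subseteq> words (e ` X) \<times> words (e ` X)"
      using w by (auto simp: words_image)
    show "refl_on (words (e ` X)) (rename_rel e r)"
    proof (rule refl_onI)
      fix x assume "x \<in> words (e ` X)"
      then obtain u where "u \<in> words X" "x = map e u" by (auto simp: words_image)
      then show "(x, x) \<in> rename_rel e r" using I[OF refl] by blast
    qed
    show "sym (rename_rel e r)"
    proof (rule symI)
      fix x y assume "(x, y) \<in> rename_rel e r"
      then obtain u v where "(u, v) \<in> r" "x = map e u" "y = map e v" by (rule E)
      then show "(y, x) \<in> rename_rel e r" using I[OF sym] by blast
    qed
    show "trans (rename_rel e r)"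
    proof (rule transI)
      fix x y z assume "(x, y) \<in> rename_rel e r" "(y, z) \<in> rename_rel e r"
      then obtain u v v' t where uv: "(u, v) \<in> r" "x = map e u" "y = map e v"
        and vt: "(v', t) \<in> r" "y = map e v'" "z = map e t" by (elim E)
      have "v = v'" using eq uv vt w by metis
      then show "(x, z) \<in> rename_rel e r"
        using I[OF trans[OF uv(1)]] uv vt by blast
    qed
    fix u1 v1 u2 v2
    assume "(u1, v1) \<in> rename_rel e r" "(u2, v2) \<in> rename_rel e r"
    then obtain x1 y1 x2 y2 where xy: "(x1, y1) \<in> r" "(x2, y2) \<in> r"
      "u1 = map e x1" "v1 = map e y1" "u2 = map e x2" "v2 = map e y2" by (elim E)
    then show "(u1 @ u2, v1 @ v2) \<in> rename_rel e r"
      using I[OF congruence_append[OF r xy(1,2)]] by simp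
  qed
qed

lemma cong_closure_least: "congruence X r \<Longrightarrow> \<sigma> \<subseteq> r \<Longrightarrow> cong_closure X \<sigma> \<subseteq> r"
  by (auto simp: cong_closure_def)

lemma rename_rel_inv_into:
  assumes "inj_on e X" "r \<subseteq> words X \<times> words X"
  shows "rename_rel (inv_into X e) (rename_rel e r) = r"
proof -
  have inv: "map (inv_into X e) (map e u) = u" if "u \<in> words X" for u
    using that assms(1) by (auto simp: words_def map_idI subset_iff)
  have "map_prod (map (inv_into X e)) (map (inv_into X e)) (map_prod (map e) (map e) p) = p"
    if "p \<in> r" for p
    using inv assms(2) that by (cases p) (simp del: map_map, blast)
  then show ?thesis by (simp add: image_image)
qed

lemma rename_rel_inv_into':
  assumes "r \<subseteq> words (e ` X) \<times> words (e ` X)"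
  shows "rename_rel e (rename_rel (inv_into X e) r) = r"
proof -
  have inv: "map e (map (inv_into X e) u) = u" if "u \<in> words (e ` X)" for u
    using that by (auto simp: words_def map_idI subset_iff f_inv_into_f)
  have "map_prod (map e) (map e) (map_prod (map (inv_into X e)) (map (inv_into X e)) p) = p"
    if "p \<in> r" for p
    using inv assms that by (cases p) (simp del: map_map, blast)
  then show ?thesis by (simp add: image_image)
qed

text \<open>Both inclusions rest on minimality of a closure; the second pulls the renamed closure
  back along \<open>inv_into X e\<close> and pushes the result forward again.\<close>

lemma cong_closure_rename:
  assumes e: "inj_on e X" and \<sigma>: "\<sigma> \<subseteq> words X \<times> words X"
  shows "cong_closure (e ` X) (rename_rel e \<sigma>) = rename_rel e (cong_closure X \<sigma>)"
proof
  show "cong_closure (e ` X) (rename_rel e \<sigma>) \<subseteq> rename_rel e (cong_closure X \<sigma>)"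
    by (intro cong_closure_least congruence_rename congruence_cong_closure[OF \<sigma>] e image_mono)
  let ?c = "cong_closure (e ` X) (rename_rel e \<sigma>)" and ?d = "inv_into X e"
  have \<sigma>': "rename_rel e \<sigma> \<subseteq> words (e ` X) \<times> words (e ` X)"
    using \<sigma> by (auto simp: words_image)
  note c = congruence_cong_closure[OF \<sigma>']
  have "inj_on ?d (e ` X)" by (rule inj_on_inv_into) simp
  then have "congruence (?d ` e ` X) (rename_rel ?d ?c)" by (rule congruence_rename[OF c(1)])
  moreover have "?d ` e ` X = X" using e by simp
  moreover have "\<sigma> \<subseteq> rename_rel ?d ?c"
    using image_mono[OF c(2)] rename_rel_inv_into[OF e \<sigma>] by metis
  ultimately have "cong_closure X \<sigma> \<subseteq> rename_rel ?d ?c" by (simp add: cong_closure_least)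
  then have "rename_rel e (cong_closure X \<sigma>) \<subseteq> rename_rel e (rename_rel ?d ?c)" by (rule image_mono)
  also have "\<dots> = ?c"
    using c(1) by (intro rename_rel_inv_into') (auto simp: congruence_def equiv_def)
  finally show "rename_rel e (cong_closure X \<sigma>) \<subseteq> ?c" .
qed

text \<open>Renaming acts on a class by direct image, which sends the class of \<open>u\<close> to
  the class of \<open>map e u\<close>.\<close>

lemma sgrp_iso_rename:
  assumes r: "congruence X r" and e: "inj_on e X"
  shows "sgrp_iso (quotient_sgrp X r) (quotient_sgrp (e ` X) (rename_rel e r))"
proof -
  let ?r = "rename_rel e r" and ?\<pi> = "image (map e)"
  note inj = inj_on_map_words[OF e] and r' = congruence_rename[OF r e]
  have cls: "?\<pi> (r `` {u}) = ?r `` {map e u}" if "u \<in> words X" for u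
  proof
    show "?r `` {map e u} \<subseteq> ?\<pi> (r `` {u})"
      using that inj_onD[OF inj] congruence_words[OF r] by (fastforce simp: image_iff)
  qed force
  have "inj_on ?\<pi> (words X // r)"
  proof (rule inj_onI)
    fix U V assume UV: "U \<in> words X // r" "V \<in> words X // r" and eq: "?\<pi> U = ?\<pi> V"
    then have "U \<subseteq> words X" "V \<subseteq> words X"
      using congruence_words[OF r] by (auto elim!: quotientE)
    then show "U = V" using eq inj_on_image_eq_iff[OF inj] by blast
  qed
  moreover have "?\<pi> ` (words X // r) = words (e ` X) // ?r"
  proof -
    have "?\<pi> ` (words X // r) = (\<lambda>u. ?\<pi> (r `` {u})) ` words X" by (auto simp: quotient_def)
    also have "\<dots> = (\<lambda>u. ?r `` {map e u}) ` words X" by (rule image_cong[OF refl cls])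
    also have "\<dots> = words (e ` X) // ?r" by (auto simp: quotient_def words_image)
    finally show ?thesis .
  qed
  ultimately have "bij_betw ?\<pi> (selems (quotient_sgrp X r)) (selems (quotient_sgrp (e ` X) ?r))"
    by (simp add: bij_betw_def quotient_sgrp_def)
  moreover have "?\<pi> (sop (quotient_sgrp X r) a b) = sop (quotient_sgrp (e ` X) ?r) (?\<pi> a) (?\<pi> b)"
    if "a \<in> selems (quotient_sgrp X r)" "b \<in> selems (quotient_sgrp X r)" for a b
  proof -
    from that obtain u v where uv: "u \<in> words X" "v \<in> words X" "a = r `` {u}" "b = r `` {v}"
      unfolding quotient_sgrp_def by (auto elim!: quotientE)
    then have uv': "map e u \<in> words (e ` X)" "map e v \<in> words (e ` X)" by (auto simp: words_image)
    show ?thesis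
      unfolding uv(3,4) cls[OF uv(1)] cls[OF uv(2)] quotient_sgrp_sop[OF r uv(1,2)]
        quotient_sgrp_sop[OF r' uv'] cls[OF words_append[OF r uv(1,2)]] map_append ..
  qed
  ultimately show ?thesis unfolding sgrp_iso_def by blast
qed

text \<open>\<open>finitely_presented\<close> admits only alphabets of natural numbers, so the
  presentation on \<open>X\<close> is carried there along an injection.\<close>

lemma finitely_presented_cong_closure:
  assumes X: "finite X" and \<sigma>: "finite \<sigma>" "\<sigma> \<subseteq> words X \<times> words X"
  shows "finitely_presented (quotient_sgrp X (cong_closure X \<sigma>))"
proof -
  obtain e :: "'a \<Rightarrow> nat" where e: "inj_on e X"
    using finite_imp_inj_to_nat_seg[OF X] by blast
  have "sgrp_iso (quotient_sgrp X (cong_closure X \<sigma>))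
      (quotient_sgrp (e ` X) (cong_closure (e ` X) (rename_rel e \<sigma>)))"
    unfolding cong_closure_rename[OF e \<sigma>(2)]
    by (rule sgrp_iso_rename[OF congruence_cong_closure(1)[OF \<sigma>(2)] e])
  moreover have "rename_rel e \<sigma> \<subseteq> words (e ` X) \<times> words (e ` X)"
    using \<sigma>(2) by (auto simp: words_image)
  ultimately show ?thesis
    unfolding finitely_presented_def using X \<sigma>(1) by (meson finite_imageI)
qed

section \<open>Finite presentation when long relations follow from shorter ones\<close>

text \<open>A finite alphabet has only finitely many relations between words shorter than
  \<open>N\<close>. Any other relation follows from strictly shorter ones, so strong induction on
  length derives it from these finitely many.\<close>

lemma finitely_presented_if_sim_in:
  assumes X: "finite X" and r: "graded_congruence X r"
    and sim: "\<And>u v. (u, v) \<in> r \<Longrightarrow> N \<le> length u \<Longrightarrow> (u, v) \<in> sim_in X r"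
  shows "finitely_presented (quotient_sgrp X r)"
proof -
  define \<sigma> where "\<sigma> = {(u, v) \<in> r. length u < N}"
  have c: "congruence X r" using r by (simp add: graded_congruence_def)
  have len: "length u = length v" if "(u, v) \<in> r" for u v
    using r that by (auto simp: graded_congruence_def)
  have \<sigma>: "\<sigma> \<subseteq> words X \<times> words X" using congruence_words[OF c] by (auto simp: \<sigma>_def)
  let ?L = "{w. set w \<subseteq> X \<and> length w \<le> N}"
  have "\<sigma> \<subseteq> ?L \<times> ?L"
    using congruence_words[OF c] by (fastforce simp: \<sigma>_def words_def dest: len)
  then have fin: "finite \<sigma>" by (rule finite_subset) (simp add: finite_lists_length_le X)
  have "(u, v) \<in> cong_closure X \<sigma>" if "(u, v) \<in> r" for u v
    using that
  proof (induction "length u" arbitrary: u v rule: less_induct)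
    case less
    show ?case
    proof (cases "length u < N")
      case True
      then show ?thesis using less.prems congruence_cong_closure(2)[OF \<sigma>] by (auto simp: \<sigma>_def)
    next
      case False
      let ?s = "{(u', v') \<in> r. length u' = length v' \<and> length u' < length u}"
      have "(u, v) \<in> cong_closure X ?s"
        using sim[OF less.prems] False by (auto simp: sim_in_def)
      moreover have "cong_closure X ?s \<subseteq> cong_closure X \<sigma>"
        using less.hyps by (intro cong_closure_least congruence_cong_closure(1)[OF \<sigma>]) auto
      ultimately show ?thesis by blast
    qed
  qed
  then have "r = cong_closure X \<sigma>"
    using cong_closure_least[OF c, of \<sigma>] by (auto simp: \<sigma>_def)
  then show ?thesis using finitely_presented_cong_closure[OF X fin \<sigma>] by simp
qed

section \<open>Matrix units\<close>

text \<open>The word \<open>u\<close> enters only through its class; this is what later allows the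
  values of \<alpha> on equivalent words to be compared.\<close>

abbreviation matrix_unit ::
    "('x list \<times> 'x list) set \<Rightarrow> nat \<Rightarrow> nat \<Rightarrow> 'x list \<Rightarrow> ('x list set, 'f::field) mat" where
  "matrix_unit r i j u \<equiv> Poly_Mapping.single (i, j) (Poly_Mapping.single (r `` {u}) 1)"

text \<open>Shows that the entry of a matrix unit is nonzero, so that the sums over keys in
  \<open>bilinear_ext\<close> reach its position.\<close>

lemma single_one_neq_0: "Poly_Mapping.single k (1 :: 'f::zero_neq_one) \<noteq> 0"
  by (metis lookup_single_eq lookup_zero zero_neq_one)

lemma mult_alg_A_biadditive:
  assumes "congruence X r"
  shows "biadditive (\<lambda>(i, j) (p, q) a b. if j = p then Poly_Mapping.single (i :: nat, q :: nat)
    (mult (sgrp_alg (quotient_sgrp X r) :: ('f::field, _) alg) a b) else 0)"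
  by (rule strict_upper_biadditive)
     (simp_all add: sgrp_alg_def bilinear_ext_add[OF sgrp_alg_biadditive])

lemma mult_alg_A_add:
  fixes a b c :: "('x list set, 'f::field) mat"
  assumes "congruence X r"
  shows "mult (alg_A X r) (a + b) c = mult (alg_A X r) a c + mult (alg_A X r) b c"
  by (simp add: alg_A_def strict_upper_def bilinear_ext_add[OF mult_alg_A_biadditive[OF assms]])

lemma mult_alg_A_zero [simp]: "mult (alg_A X r) 0 c = 0" "mult (alg_A X r) c 0 = 0"
  by (simp_all add: alg_A_def strict_upper_def)

lemma mult_alg_A_sum:
  fixes c :: "('x list set, 'f::field) mat"
  assumes "congruence X r"
  shows "mult (alg_A X r) (\<Sum>i\<in>I. h i) c = (\<Sum>i\<in>I. mult (alg_A X r) (h i) c)"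
  by (induction I rule: infinite_finite_induct) (simp_all add: mult_alg_A_add[OF assms])

lemma mult_matrix_unit:
  assumes r: "congruence X r" and uv: "u \<in> words X" "v \<in> words X"
  shows "mult (alg_A X r) (matrix_unit r i j u :: (_, 'f::field) mat) (matrix_unit r p q v) =
    (if j = p then matrix_unit r i q (u @ v) else 0)"
proof -
  have "mult (sgrp_alg (quotient_sgrp X r)) (Poly_Mapping.single (r `` {u}) (1::'f))
      (Poly_Mapping.single (r `` {v}) 1) = Poly_Mapping.single (r `` {u @ v}) 1"
    by (simp add: sgrp_alg_def bilinear_ext_single[OF sgrp_alg_biadditive] quotient_sgrp_sop[OF r uv])
  then show ?thesis
    by (simp add: alg_A_def strict_upper_def bilinear_ext_single[OF mult_alg_A_biadditive[OF r]]
        single_one_neq_0)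
qed

lemma matrix_unit_carr:
  assumes "u \<in> words X" "1 \<le> i" "i < j"
  shows "matrix_unit r i j u \<in> carr (alg_A X r)"
  using assms
  by (auto simp: alg_A_def strict_upper_def sgrp_alg_def quotient_sgrp_def lookup_single intro: quotientI)

lemma form_f_matrix_unit:
  assumes r: "graded_congruence X r"
    and \<alpha>: "\<forall>u\<in>words X. \<forall>v\<in>words X. \<alpha> u = \<alpha> v \<longleftrightarrow> (u, v) \<in> sim_in X r"
    and uv: "u \<in> words X" "v \<in> words X"
  shows "form_f \<alpha> (matrix_unit r i j u :: (_, 'f::field) mat) (matrix_unit r p q v) =
    (if j = p then \<alpha> (u @ v) else 0)"
  by (simp add: form_f_def bilinear_ext_single[OF form_f_biadditive[OF r \<alpha>]]
      bilinear_ext_single[OF entry_form_biadditive[OF r \<alpha>]] form_h_class[OF r \<alpha> uv]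
      single_one_neq_0)

section \<open>Matrix units in \<open>P(A)\<close>\<close>

text \<open>Framing words by two fixed letters is injective, so coefficients move without merging.
  With suitably fresh letters the frame lets a substitution single out one monomial.\<close>

lemma free_alg_sandwich:
  fixes p :: "nat list \<Rightarrow>\<^sub>0 'f::field" and a b :: nat
  defines "q \<equiv> mult free_alg (mult free_alg (Poly_Mapping.single [a] 1) p) (Poly_Mapping.single [b] 1)"
  shows "Poly_Mapping.keys q \<subseteq> (\<lambda>w. a # w @ [b]) ` Poly_Mapping.keys p"
    and "Poly_Mapping.lookup q (a # w @ [b]) = Poly_Mapping.lookup p w"
proof -
  note K = sgrp_alg_biadditive[where ?'f = 'f and S = "free_sgrp UNIV :: nat list sgrp"]
  have q: "q = (\<Sum>w\<in>Poly_Mapping.keys p. Poly_Mapping.single (a # w @ [b]) (Poly_Mapping.lookup p w))"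
    unfolding q_def free_alg_def sgrp_alg_def alg.simps
    by (simp add: bilinear_ext_single(1)[OF K] bilinear_ext_sum[OF K])
       (simp add: bilinear_ext_single[OF K] free_sgrp_def)
  show "Poly_Mapping.keys q \<subseteq> (\<lambda>w. a # w @ [b]) ` Poly_Mapping.keys p"
    unfolding q by (intro order.trans[OF keys_sum] UN_least) auto
  have "Poly_Mapping.lookup q (a # w @ [b]) =
      (\<Sum>w'\<in>Poly_Mapping.keys p. if w' = w then Poly_Mapping.lookup p w' else 0)"
    unfolding q lookup_sum by (intro sum.cong refl) (simp add: lookup_single when_def)
  then show "Poly_Mapping.lookup q (a # w @ [b]) = Poly_Mapping.lookup p w"
    by (simp add: in_keys_iff)
qed

text \<open>
  Spread the letters of \<open>v\<close> along the superdiagonal: the substitution sends \<open>x\<close> to the sum of the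
  \<open>e\<^sub>i\<^sub>+\<^sub>t\<^sub>,\<^sub>i\<^sub>+\<^sub>t\<^sub>+\<^sub>1\<close> over the positions \<open>t\<close> at which \<open>v\<close> has the letter \<open>x\<close>, so that a word reaching the
  last column \<open>k\<close> must trace a suffix of \<open>v @ [b]\<close>.
\<close>

definition path_subst ::
    "('x list \<times> 'x list) set \<Rightarrow> nat \<Rightarrow> nat \<Rightarrow> 'x list \<Rightarrow> nat list \<Rightarrow> nat \<Rightarrow> nat \<Rightarrow>
      ('x list set, 'f::field) mat" where
  "path_subst r i k u v b x =
     (if x = b then matrix_unit r (i + length v) k (drop (length v) u)
      else \<Sum>t | t < length v \<and> v ! t = x. matrix_unit r (i + t) (i + t + 1) [u ! t])"

text \<open>Induction builds the product from its right end, starting with the unit for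
  \<open>b\<close>. A further letter on the left must end in the current row, which selects one
  position of \<open>v\<close>; the product survives exactly when that position carries the letter.
  Each such step contributes one letter of \<open>u\<close>, and the nonempty rest of
  \<open>u\<close> sits on the unit for \<open>b\<close>.\<close>

lemma word_prod_path_subst:
  fixes r :: "('x list \<times> 'x list) set"
  assumes r: "congruence X r" and u: "u \<in> words X" "length v < length u"
    and k: "i + length v < k" and b: "b \<notin> set v"
  defines "s \<equiv> (path_subst r i k u v b :: nat \<Rightarrow> (_, 'f::field) mat)"
  shows "word_prod (alg_A X r) (map s (xs @ [b])) =
    (if \<exists>t\<le>length v. xs = drop t v
     then matrix_unit r (i + (length v - length xs)) k (drop (length v - length xs) u) else 0)"
proof (induction xs)
  case Nil
  then show ?case by (auto simp: s_def path_subst_def)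
next
  case (Cons x xs)
  let ?A = "alg_A X r :: ('f, ('x list set, 'f) mat) alg"
  let ?t = "length v - length xs"
  have "map s (xs @ [b]) \<noteq> []" by simp
  then have step: "word_prod ?A (map s ((x # xs) @ [b])) = mult ?A (s x) (word_prod ?A (map s (xs @ [b])))"
    by (cases "map s (xs @ [b])") auto
  show ?case
  proof (cases "\<exists>t\<le>length v. xs = drop t v")
    case False
    \<comment> \<open>The tail of a nonempty suffix is a suffix, so a product that has vanished
      stays zero.\<close>
    then have nex: "\<not> (\<exists>t\<le>length v. x # xs = drop t v)"
    proof safe
      fix t assume t: "t \<le> length v" "x # xs = drop t v"
      from arg_cong[OF t(2), of length] have "Suc t \<le> length v" using t(1) by simp
      moreover have "xs = drop (Suc t) v" using t(2) by (metis drop_Suc list.sel(3) tl_drop)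
      ultimately show False using False by blast
    qed
    then show ?thesis unfolding step Cons.IH if_not_P[OF False] if_not_P[OF nex] by simp
  next
    case True
    then have xs: "length xs \<le> length v" "drop ?t v = xs" by auto
    have du: "drop ?t u \<in> words X"
      using u set_drop_subset[of ?t u] by (auto simp: words_def)
    \<comment> \<open>\<open>?t\<close> is the position in \<open>v\<close> where the suffix
      \<open>xs\<close> starts, so the only candidate for \<open>x\<close> is the letter just before
      it.\<close>
    have suff: "(\<exists>t\<le>length v. x # xs = drop t v) \<longleftrightarrow> ?t > 0 \<and> v ! (?t - 1) = x"
    proof
      assume "\<exists>t\<le>length v. x # xs = drop t v"
      then obtain t where t: "t \<le> length v" "x # xs = drop t v" by blast
      from arg_cong[OF t(2), of length] have "Suc (length xs) = length v - t" by simp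
      then have "?t = Suc t" "t < length v" using t(1) by auto
      moreover have "x = v ! t" using t(2) \<open>t < length v\<close> by (metis Cons_nth_drop_Suc list.inject)
      ultimately show "?t > 0 \<and> v ! (?t - 1) = x" by simp
    next
      assume *: "?t > 0 \<and> v ! (?t - 1) = x"
      then have "drop (?t - 1) v = v ! (?t - 1) # drop (Suc (?t - 1)) v"
        by (intro Cons_nth_drop_Suc[symmetric]) linarith
      also have "Suc (?t - 1) = ?t" using * by linarith
      finally have "x # xs = drop (?t - 1) v" using * xs(2) by simp
      moreover have "?t - 1 \<le> length v" by linarith
      ultimately show "\<exists>t\<le>length v. x # xs = drop t v" by blast
    qed
    have "mult ?A (s x) (matrix_unit r (i + ?t) k (drop ?t u)) =
      (if ?t > 0 \<and> v ! (?t - 1) = x then matrix_unit r (i + (?t - 1)) k (drop (?t - 1) u) else 0)"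
    proof (cases "x = b")
      case True
      have "drop (length v) u \<in> words X"
        using u set_drop_subset[of "length v" u] by (auto simp: words_def)
      \<comment> \<open>The unit for \<open>b\<close> ends in column \<open>k\<close>, beyond row
        \<open>i + ?t\<close>, so a second \<open>b\<close> kills the product.\<close>
      moreover have "k \<noteq> i + ?t" using k by linarith
      moreover have nb: "\<not> (?t > 0 \<and> v ! (?t - 1) = x)"
        using b True nth_mem[of "?t - 1" v] by auto
      ultimately show ?thesis
        unfolding if_not_P[OF nb] using True by (simp add: s_def path_subst_def mult_matrix_unit[OF r _ du])
    next
      case False
      have ut: "[u ! t] \<in> words X" if "t < length v" for t
        using u that by (auto simp: words_def)
      have "mult ?A (s x) (matrix_unit r (i + ?t) k (drop ?t u)) =
         (\<Sum>t | t < length v \<and> v ! t = x.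
            if i + t + 1 = i + ?t then matrix_unit r (i + t) k ([u ! t] @ drop ?t u) else 0)"
        using False by (simp add: s_def path_subst_def mult_alg_A_sum[OF r])
          (intro sum.cong refl, simp add: mult_matrix_unit[OF r ut du])
      \<comment> \<open>The guard \<open>?t > 0\<close> compensates for truncated subtraction: at
        \<open>?t = 0\<close> no position matches, although \<open>?t - 1\<close> is 0.\<close>
      also have "\<dots> = (\<Sum>t | t < length v \<and> v ! t = x.
            if t = ?t - 1 then (if ?t > 0 then matrix_unit r (i + t) k ([u ! t] @ drop ?t u) else 0) else 0)"
        by (intro sum.cong refl) auto
      also have "\<dots> = (if ?t > 0 \<and> v ! (?t - 1) = x
          then matrix_unit r (i + (?t - 1)) k ([u ! (?t - 1)] @ drop ?t u) else 0)"
        by (subst sum.delta) auto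
      finally have main: "mult ?A (s x) (matrix_unit r (i + ?t) k (drop ?t u)) =
         (if ?t > 0 \<and> v ! (?t - 1) = x
          then matrix_unit r (i + (?t - 1)) k ([u ! (?t - 1)] @ drop ?t u) else 0)" .
      have unit: "[u ! (?t - 1)] @ drop ?t u = drop (?t - 1) u" if "?t > 0"
        using that u(2) Cons_nth_drop_Suc[of "?t - 1" u] by (simp add: Suc_diff_Suc)
      show ?thesis
        unfolding main by (rule if_cong[OF refl _ refl], erule conjE) (simp only: unit)
    qed
    moreover have "length v - length (x # xs) = ?t - 1" by simp
    ultimately show ?thesis unfolding step Cons.IH if_P[OF True] suff by (simp only:)
  qed
qed

text \<open>A nonzero element of \<open>P\<close>, normalised at one of its words \<open>w\<close>
  and framed by letters \<open>a\<close> and \<open>b\<close>, is evaluated at the path substitution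
  for \<open>a # w\<close>. Among its monomials only the one from \<open>w\<close> survives, and its
  value is the matrix unit.\<close>

lemma matrix_unit_values_on:
  fixes X :: "'x set" and P :: "(nat list \<Rightarrow>\<^sub>0 'f::field) set"
  assumes r: "congruence X r" and A: "assoc_alg (alg_A X r :: ('f, ('x list set, 'f) mat) alg)"
    and P: "alg_ideal free_alg P" "P \<noteq> {0}"
  obtains m where "\<And>i k u. 1 \<le> i \<Longrightarrow> i + m \<le> k \<Longrightarrow> u \<in> words X \<Longrightarrow> m \<le> length u \<Longrightarrow>
    matrix_unit r i k u \<in> values_on P (alg_A X r)"
proof -
  let ?A = "alg_A X r :: ('f, ('x list set, 'f) mat) alg"
  obtain p where p: "p \<in> P" "p \<noteq> 0" using P unfolding alg_ideal_def by blast
  then obtain w where w: "w \<in> Poly_Mapping.keys p" by (metis all_not_in_conv keys_eq_empty)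
  \<comment> \<open>Freshness of \<open>a\<close> makes \<open>a # w\<close> its only suffix
    starting with \<open>a\<close>; freshness of \<open>b\<close> keeps the closing unit off the
    path.\<close>
  obtain a where a: "a \<notin> set w"
    using ex_new_if_finite[OF infinite_UNIV_nat finite_set] by blast
  obtain b where b: "b \<notin> set (a # w)"
    using ex_new_if_finite[OF infinite_UNIV_nat finite_set] by blast
  have ab: "a \<notin> set w" "b \<notin> set w" "a \<noteq> b" using a b by auto
  define c where "c = inverse (Poly_Mapping.lookup p w)"
  define p' where "p' = scale free_alg c p"
  have "p' \<in> P" using P(1) p(1) unfolding alg_ideal_def p'_def by blast
  have p'w: "Poly_Mapping.lookup p' w = 1"
    using w by (simp add: p'_def free_alg_def sgrp_alg_def lookup_map0 c_def in_keys_iff)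
  define q where "q = mult free_alg (mult free_alg (Poly_Mapping.single [a] 1) p') (Poly_Mapping.single [b] 1)"
  have "Poly_Mapping.single [x] 1 \<in> carr (free_alg :: ('f, _) alg)" for x
    by (auto simp: free_alg_def sgrp_alg_def free_sgrp_def words_def)
  then have q: "q \<in> P" using P(1) \<open>p' \<in> P\<close> unfolding alg_ideal_def q_def by blast
  let ?v = "a # w"
  have qk: "Poly_Mapping.keys q \<subseteq> (\<lambda>w. a # w @ [b]) ` Poly_Mapping.keys p'"
    and qw: "Poly_Mapping.lookup q (?v @ [b]) = 1"
    using free_alg_sandwich(1)[of a p' b] free_alg_sandwich(2)[of a p' b w] p'w by (simp_all add: q_def)
  show thesis
  \<comment> \<open>The path takes one superdiagonal step per letter of \<open>?v\<close>; the
    closing unit needs one more column and one more letter of \<open>u\<close>.\<close>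
  proof (rule that[of "length ?v + 1"])
    fix i k and u :: "'x list"
    assume ik: "1 \<le> i" "i + (length ?v + 1) \<le> k" and u: "u \<in> words X" "length ?v + 1 \<le> length u"
    define s where "s = (path_subst r i k u ?v b :: nat \<Rightarrow> (_, 'f) mat)"
    have Asum: "sum h I \<in> carr ?A" if "\<And>t. t \<in> I \<Longrightarrow> h t \<in> carr ?A" for h and I :: "nat set"
      using that A by (induction I rule: infinite_finite_induct) (auto simp: assoc_alg_def)
    have "s x \<in> carr ?A" for x
    proof -
      have "drop (length ?v) u \<in> words X"
        using u set_drop_subset[of "length ?v" u] by (auto simp: words_def)
      moreover have "[u ! t] \<in> words X" if "t < length ?v" for t
        using u that nth_mem[of t u] by (auto simp: words_def)
      ultimately show ?thesis using ik
        unfolding s_def path_subst_def by (auto intro!: Asum matrix_unit_carr)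
    qed
    then have s: "range s \<subseteq> carr ?A" by blast
    have wp: "word_prod ?A (map s v') = (if v' = ?v @ [b] then matrix_unit r i k u else 0)"
      if v': "v' \<in> Poly_Mapping.keys q" for v'
    proof -
      obtain w' where w': "v' = (a # w') @ [b]" using subsetD[OF qk v'] by (elim imageE) simp
      \<comment> \<open>the letter \<open>a\<close> occurs in \<open>a # w\<close> only at the front, so the only suffix starting with it is the whole word\<close>
      have suff: "(\<exists>t\<le>length ?v. a # w' = drop t ?v) \<longleftrightarrow> w' = w"
      proof
        assume "\<exists>t\<le>length ?v. a # w' = drop t ?v"
        then obtain t where t: "a # w' = drop t ?v" by blast
        show "w' = w"
        proof (cases t)
          case 0
          then show ?thesis using t by simp
        next
          case (Suc t')
          then have "a \<in> set (drop t' w)" using t by (metis drop_Suc_Cons list.set_intros(1))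
          then show ?thesis using ab(1) in_set_dropD[of a t' w] by simp
        qed
      next
        assume "w' = w"
        then have "a # w' = drop 0 ?v" by simp
        then show "\<exists>t\<le>length ?v. a # w' = drop t ?v" by blast
      qed
      have "word_prod ?A (map s ((a # w') @ [b])) =
        (if \<exists>t\<le>length ?v. a # w' = drop t ?v
         then matrix_unit r (i + (length ?v - length (a # w'))) k (drop (length ?v - length (a # w')) u) else 0)"
        unfolding s_def by (rule word_prod_path_subst[OF r u(1)]) (use u ik ab in simp_all)
      then show ?thesis unfolding w' suff by (cases "w' = w") simp_all
    qed
    have sc: "scale ?A c 0 = 0" "scale ?A 1 x = x" for c x
      by (auto simp: alg_A_def strict_upper_def sgrp_alg_def lookup_map0 intro!: poly_mapping_eqI)
    have "eval_at ?A s q = (\<Sum>v'\<in>Poly_Mapping.keys q. if v' = ?v @ [b] then matrix_unit r i k u else 0)"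
      unfolding eval_at_def by (intro sum.cong refl) (auto simp: wp sc qw[simplified])
    also have "\<dots> = matrix_unit r i k u"
      using qw by (simp add: in_keys_iff)
    finally show "matrix_unit r i k u \<in> values_on P ?A"
      unfolding values_on_def using q s by (intro CollectI exI[of _ s] exI[of _ q]) simp
  qed
qed

section \<open>Standard decompositions\<close>

text \<open>When the product of the two sums is expanded, the mixed terms vanish by
  \<open>ann\<close>; the other two are \<open>\<psi>1\<close> of the product and
  \<open>\<psi>2\<close> of the reversed product.\<close>

lemma standard_mult:
  fixes D :: "('f::field, 'b::ab_group_add) alg"
  assumes D: "assoc_alg D" and hom: "alg_hom C D \<psi>1" "alg_antihom C D \<psi>2"
    and \<psi>: "\<And>x. x \<in> carr C \<Longrightarrow> \<psi> x = \<psi>1 x + \<psi>2 x"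
    and ann: "\<And>x y. x \<in> carr C \<Longrightarrow> y \<in> carr C \<Longrightarrow> mult D (\<psi>1 x) (\<psi>2 y) = 0 \<and> mult D (\<psi>2 x) (\<psi>1 y) = 0"
    and xy: "x \<in> carr C" "y \<in> carr C"
  shows "mult D (\<psi> x) (\<psi> y) = \<psi>1 (mult C x y) + \<psi>2 (mult C y x)"
proof -
  have "\<psi>1 x \<in> carr D" "\<psi>1 y \<in> carr D" "\<psi>2 x \<in> carr D" "\<psi>2 y \<in> carr D"
    using hom xy by (auto simp: alg_hom_def alg_antihom_def linear_map_def)
  moreover have distrib: "mult D (a + b) c = mult D a c + mult D b c"
    "mult D a (b + c) = mult D a b + mult D a c" if "a \<in> carr D" "b \<in> carr D" "c \<in> carr D" for a b c
    using D that by (auto simp: assoc_alg_def)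
  moreover have "a + b \<in> carr D" if "a \<in> carr D" "b \<in> carr D" for a b
    using D that by (auto simp: assoc_alg_def)
  ultimately show ?thesis
    using hom ann xy by (simp add: \<psi> alg_hom_def alg_antihom_def)
qed

section \<open>Contradiction from a standard decomposition\<close>

theorem proposition3p12:
  fixes X :: "'x set"
    and r :: "('x list \<times> 'x list) set"
    and \<alpha> :: "'x list \<Rightarrow> 'f::field"
    and P :: "(nat list \<Rightarrow>\<^sub>0 'f) set"
  assumes "infinite (UNIV :: 'f set)"
    and "CHAR('f) \<noteq> 2"
    and "finite X"
    and "graded_congruence X r"
    and "\<not> finitely_presented (quotient_sgrp X r)"
    and "\<forall>u\<in>words X. \<forall>v\<in>words X. \<alpha> u = \<alpha> v \<longleftrightarrow> (u, v) \<in> sim_in X r"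
    and "T_ideal P"
    and "P \<noteq> {0}"
  shows "\<not> standard (verbal P (alg_A X r)) (alg_B X r \<alpha>) phi"
proof
  let ?A = "alg_A X r :: ('f, ('x list set, 'f) mat) alg" and ?B = "alg_B X r \<alpha>"
  let ?C = "verbal P ?A"
  note graded = assms(4) and \<alpha> = assms(6)
  note r = graded_cong[OF graded \<alpha>]
  assume "standard ?C ?B phi"
  then obtain \<psi>1 \<psi>2 where hom: "alg_hom ?C ?B \<psi>1" "alg_antihom ?C ?B \<psi>2"
    and \<psi>: "\<And>x. x \<in> carr ?C \<Longrightarrow> phi x = \<psi>1 x + \<psi>2 x"
    and ann: "\<And>x y. x \<in> carr ?C \<Longrightarrow> y \<in> carr ?C \<Longrightarrow> mult ?B (\<psi>1 x) (\<psi>2 y) = 0 \<and> mult ?B (\<psi>2 x) (\<psi>1 y) = 0"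
    unfolding standard_def by blast
  have ideal: "alg_ideal free_alg P" using assms(7) by (simp add: T_ideal_def)
  obtain m where m: "\<And>i k u. 1 \<le> i \<Longrightarrow> i + m \<le> k \<Longrightarrow> u \<in> words X \<Longrightarrow> m \<le> length u \<Longrightarrow>
    matrix_unit r i k u \<in> values_on P ?A"
    using matrix_unit_values_on[OF r assoc_alg_A[OF graded \<alpha>] ideal assms(8)] by blast
  have carrC: "carr ?C = values_on P ?A" "mult ?C = mult ?A" by (simp_all add: verbal_def)
  \<comment> \<open>Additivity of \<open>\<psi>2\<close> is known only on the carrier, so 0 has to
    be a value of \<open>P\<close> before \<open>\<psi>2 0 = 0\<close> can be derived.\<close>
  have zero: "0 \<in> carr ?C"
  proof -
    have "range (\<lambda>_. 0) \<subseteq> carr ?A" using assoc_alg_A[OF graded \<alpha>] by (auto simp: assoc_alg_def)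
    moreover have "0 \<in> P" using ideal by (simp add: alg_ideal_def)
    moreover have "eval_at ?A (\<lambda>_. 0) 0 = 0" by (simp add: eval_at_def)
    ultimately show ?thesis unfolding carrC values_on_def by force
  qed
  have "\<psi>2 (0 + 0) = \<psi>2 0 + \<psi>2 0"
    using hom(2) zero unfolding alg_antihom_def linear_map_def by blast
  then have \<psi>2_0: "\<psi>2 0 = 0" by simp
  \<comment> \<open>The index gaps are \<open>m\<close> and \<open>m + 1\<close>, large enough for
    both factors; the extra 1 keeps \<open>k\<close> different from 1 even if \<open>m = 0\<close>,
    so that the reversed product vanishes.\<close>
  define j k where "j = m + 1" and "k = 2 * m + 2"
  have \<psi>1: "\<psi>1 (matrix_unit r 1 k (u @ v)) = ((matrix_unit r 1 k (u @ v), 0), \<alpha> (u @ v))"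
    if uv: "u \<in> words X" "v \<in> words X" "m \<le> length u" "m \<le> length v" for u v
  proof -
    let ?x = "matrix_unit r 1 j u :: (_, 'f) mat" and ?y = "matrix_unit r j k v :: (_, 'f) mat"
    have xy: "?x \<in> carr ?C" "?y \<in> carr ?C" unfolding carrC by (auto intro!: m uv simp: j_def k_def)
    have k1: "k \<noteq> 1" by (simp add: k_def)
    have "mult ?B (phi ?x) (phi ?y) = \<psi>1 (mult ?C ?x ?y) + \<psi>2 (mult ?C ?y ?x)"
      by (rule standard_mult[OF assoc_alg_B[OF graded \<alpha>] hom \<psi> ann xy])
    also have "\<dots> = \<psi>1 (matrix_unit r 1 k (u @ v))"
      unfolding carrC using k1 by (simp add: mult_matrix_unit[OF r] uv \<psi>2_0)
    \<comment> \<open>The opposite component is the reversed product, which is 0, and the form there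
      vanishes too; the coefficient of z is therefore \<alpha> of the concatenation.\<close>
    also have "mult ?B (phi ?x) (phi ?y) = ((matrix_unit r 1 k (u @ v), 0), \<alpha> (u @ v))"
      using k1 by (simp add: alg_B_def central_ext_def direct_sum_def op_alg_def form_ext_def phi_def
          mult_matrix_unit[OF r] form_f_matrix_unit[OF graded \<alpha>] uv)
    finally show ?thesis by simp
  qed
  have "(u, v) \<in> sim_in X r" if uv: "(u, v) \<in> r" and len: "2 * m + 2 \<le> length u" for u v
  proof -
    have w: "u \<in> words X" "v \<in> words X" using congruence_words[OF r uv] by auto
    have "length u = length v" using graded uv by (auto simp: graded_congruence_def)
    then have lv: "2 * m + 2 \<le> length v" using len by simp
    \<comment> \<open>Cutting after \<open>m + 1\<close> letters leaves two nonempty factors, each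
      of length at least \<open>m\<close>.\<close>
    have split: "\<psi>1 (matrix_unit r 1 k w) = ((matrix_unit r 1 k w, 0), \<alpha> w)"
      if "w \<in> words X" "2 * m + 2 \<le> length w" for w
      using \<psi>1[of "take (m + 1) w" "drop (m + 1) w"] that
        set_take_subset[of "m + 1" w] set_drop_subset[of "m + 1" w] by (auto simp: words_def)
    \<comment> \<open>Equal classes give the same argument of \<open>\<psi>1\<close>, so the
      coefficients of z must agree.\<close>
    have "r `` {u} = r `` {v}" by (rule equiv_class_eq[OF congruence_equiv[OF r] uv])
    then have "\<alpha> u = \<alpha> v" using split[OF w(1) len] split[OF w(2) lv] by simp
    then show ?thesis using \<alpha> w by blast
  qed
  then show False using finitely_presented_if_sim_in[OF assms(3) graded] assms(5) by blast
qed

end
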